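(* Let $A$ be an alphabet and let $K$ be one of $K_1$, $K_2$, $K_3$. The quantitative language-equivalence problem for weighted Büchi automata over $K$ and $A$ is decidable: there is an algorithm that, given weighted Büchi automata $\mathcal{N},\widehat{\mathcal{N}}$ over $K$ and $A$, decides whether $\|\mathcal{N}\|=\|\widehat{\mathcal{N}}\|$.
   Context: $\overline{\mathbb{Q}}=\mathbb{Q}\cup\{\infty,-\infty\}$ with its usual order. In each of $K_1,K_2,K_3$ the carrier is $\overline{\mathbb{Q}}$, addition (binary and infinitary) is $\sup$ with zero $-\infty$, product is $\inf$ with unit $\infty$; the $\omega$-valuation functions on sequences $(d_i)_{i\ge0}$ with finitely many values are: for $K_1$, $\mathrm{liminf}$: $-\infty$ if some $d_i=-\infty$; $\infty$ if all $d_i=\infty$; $\sup_{i\ge0}\inf\{d_k\mid k\ge i,d_k\ne\infty\}$ if no $-\infty$ and infinitely many $d_i\ne\infty$; $\inf\{d_i\mid d_i\ne\infty\}$ otherwise. For $K_2$, $\mathrm{limsup}$: same cases but with $\inf_{i\ge0}\sup\{d_k\mid k\ge i,d_k\ne\infty\}$ in the third case and $\sup\{d_i\mid d_i\ne\infty\}$ in the last. For $K_3$, $\sup_{-\infty}$: $-\infty$ if some $d_i=-\infty$; $\infty$ if all $d_i=\infty$; $\sup\{d_k\mid d_k\ne\infty\}$ otherwise. A weighted Büchi automaton over $A$ and $K$ is $(Q,wt,I,F)$ with finite $Q$, $wt:Q\times A\times Q\to\overline{\mathbb{Q}}$, $I,F\subseteq Q$; the weight of a path $(q_j,a_j,q_{j+1})_{j\ge0}$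 is the $\omega$-valuation of $(wt(q_j,a_j,q_{j+1}))_j$; a path is successful if $q_0\in I$ and some state of $F$ occurs infinitely often; the behavior $(\|\mathcal{A}\|,w)$ is the supremum of the weights of successful paths over $w$ ($-\infty$ if none). *)

theory Defs
  imports Complex_Main "HOL-Library.Extended_Real" "HOL-Library.Nat_Bijection"
begin

datatype qbar = NegInf | Fin rat | PosInf

text \<open>Order-embedding of Q-bar into the extended reals; all suprema/infima
below are taken in ereal (they range over finitely many values, so they are
attained and agree with the ones computed in Q-bar).\<close>
fun emb :: "qbar \<Rightarrow> ereal" where
  "emb NegInf = -\<infinity>"
| "emb PosInf = \<infinity>"
| "emb (Fin r) = ereal (of_rat r)"

datatype valmonoid = K1 | K2 | K3

definition val :: "valmonoid \<Rightarrow> (nat \<Rightarrow> ereal) \<Rightarrow> ereal" where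
  "val K d =
     (if \<exists>i. d i = -\<infinity> then -\<infinity>
      else if \<forall>i. d i = \<infinity> then \<infinity>
      else (case K of
        K1 \<Rightarrow> (if infinite {i. d i \<noteq> \<infinity>}
               then (SUP i. INF k\<in>{k. i \<le> k \<and> d k \<noteq> \<infinity>}. d k)
               else (INF i\<in>{i. d i \<noteq> \<infinity>}. d i))
      | K2 \<Rightarrow> (if infinite {i. d i \<noteq> \<infinity>}
               then (INF i. SUP k\<in>{k. i \<le> k \<and> d k \<noteq> \<infinity>}. d k)
               else (SUP i\<in>{i. d i \<noteq> \<infinity>}. d i))
      | K3 \<Rightarrow> (SUP k\<in>{k. d k \<noteq> \<infinity>}. d k)))"

text \<open>States are 0..<nstates, the alphabet is 0..<m.\<close>
datatype wba = WBA (nstates: nat) (wt: "nat \<Rightarrow> nat \<Rightarrow> nat \<Rightarrow> qbar") (init: "nat set") (fin: "nat set")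

definition wf_wba :: "nat \<Rightarrow> wba \<Rightarrow> bool" where
  "wf_wba m N \<longleftrightarrow> init N \<subseteq> {..<nstates N} \<and> fin N \<subseteq> {..<nstates N}"

definition successful :: "wba \<Rightarrow> (nat \<Rightarrow> nat) \<Rightarrow> bool" where
  "successful N q \<longleftrightarrow> (\<forall>j. q j < nstates N) \<and> q 0 \<in> init N
     \<and> (\<exists>f\<in>fin N. \<exists>\<^sub>\<infinity>j. q j = f)"

definition path_weight :: "valmonoid \<Rightarrow> wba \<Rightarrow> (nat \<Rightarrow> nat) \<Rightarrow> (nat \<Rightarrow> nat) \<Rightarrow> ereal" where
  "path_weight K N w q = val K (\<lambda>j. emb (wt N (q j) (w j) (q (Suc j))))"

definition behavior :: "valmonoid \<Rightarrow> wba \<Rightarrow> (nat \<Rightarrow> nat) \<Rightarrow> ereal" where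
  "behavior K N w = Sup {path_weight K N w q | q. successful N q}"

datatype recf = Z | S | Id nat | Cn recf "recf list" | Pr recf recf | Mn recf

inductive rec_eval :: "recf \<Rightarrow> nat list \<Rightarrow> nat \<Rightarrow> bool" where
  z: "rec_eval Z xs 0"
| s: "rec_eval S (x # xs) (Suc x)"
| id: "i < length xs \<Longrightarrow> rec_eval (Id i) xs (xs ! i)"
| cn: "length ys = length gs \<Longrightarrow> (\<forall>j<length gs. rec_eval (gs ! j) xs (ys ! j))
        \<Longrightarrow> rec_eval f ys y \<Longrightarrow> rec_eval (Cn f gs) xs y"
| pr0: "rec_eval f xs y \<Longrightarrow> rec_eval (Pr f g) (0 # xs) y"
| prS: "rec_eval (Pr f g) (n # xs) y \<Longrightarrow> rec_eval g (n # y # xs) z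
        \<Longrightarrow> rec_eval (Pr f g) (Suc n # xs) z"
| mn: "rec_eval f (n # xs) 0 \<Longrightarrow> (\<forall>k<n. \<exists>v. rec_eval f (k # xs) v \<and> 0 < v)
        \<Longrightarrow> rec_eval (Mn f) xs n"

definition enc_rat :: "rat \<Rightarrow> nat" where
  "enc_rat r = (case quotient_of r of (p, q) \<Rightarrow> prod_encode (int_encode p, int_encode q))"

fun enc_qbar :: "qbar \<Rightarrow> nat" where
  "enc_qbar NegInf = 0"
| "enc_qbar PosInf = 1"
| "enc_qbar (Fin r) = Suc (Suc (enc_rat r))"

definition enc_wba :: "nat \<Rightarrow> wba \<Rightarrow> nat" where
  "enc_wba m N = (let n = nstates N in
     list_encode
       [n,
        list_encode [enc_qbar (wt N p a q). p \<leftarrow> [0..<n], a \<leftarrow> [0..<m], q \<leftarrow> [0..<n]],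
        list_encode [if p \<in> init N then 1 else 0. p \<leftarrow> [0..<n]],
        list_encode [if p \<in> fin N then 1 else 0. p \<leftarrow> [0..<n]]])"

end

theory Submission
  imports Defs "HOL-Library.Ramsey"
begin

text \<open>
  The profile of a finite word records, for every pair of states, the sets of edges used by the
  paths between them along that word. Profiles multiply under concatenation and there are finitely
  many of them. By Ramsey's theorem every infinite word splits into a block of profile \<open>s\<close> followed
  by blocks of one idempotent profile \<open>e\<close> with \<open>s e = s\<close>, and its behavior depends only on \<open>(s, e)\<close>,
  because a weight is determined by the edges used and the edges used infinitely often. The
  pigeonhole principle provides short representatives of \<open>s\<close> and \<open>e\<close>, so equivalence amounts
  to comparing lasso-shaped runs over words of bounded length. Words and runs are coded as digit
  sequences of numbers, which turns this into an arithmetical formula with bounded quantifiers.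
\<close>

section \<open>Recursive functions\<close>

text \<open>Neither profiles nor behaviors are ever coded as numbers. The laws
  \<open>s e = s\<close> and \<open>e e = e\<close> are expressed on one finite word with marks
  \<open>i < j < k\<close>, by equating profiles of its segments, and equality of profiles unfolds
  to bounded quantifiers over runs. Likewise no supremum is computed: \<open>\<le>\<close> between
  two behaviors means that each lasso of one automaton is dominated by a lasso of the other. The
  obstacle is the value \<open>-\<infinity>\<close>, since a single such edge overrides everything
  that recurs. Runs through such an edge cannot raise a supremum and are dropped; for the others the
  two sets of edges determine the weight. The marks are bounded by three times the number of
  possible profiles: once for the stem and once for each of two copies of the cycle word, the second
  copy being there to witness idempotence.\<close>

definition computable :: "(nat \<Rightarrow> nat) \<Rightarrow> bool" where
  "computable f \<longleftrightarrow> (\<exists>r. \<forall>x. rec_eval r [x] (f x))"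

text \<open>Binary functions serve only as building blocks. All closure rules speak about unary
  functions of one context in which several variables are packed by pairing.\<close>

definition computable2 :: "(nat \<Rightarrow> nat \<Rightarrow> nat) \<Rightarrow> bool" where
  "computable2 f \<longleftrightarrow> (\<exists>r. \<forall>x y. rec_eval r [x, y] (f x y))"

definition decidable :: "(nat \<Rightarrow> bool) \<Rightarrow> bool" where
  "decidable P \<longleftrightarrow> computable (\<lambda>x. of_bool (P x))"

definition pfst :: "nat \<Rightarrow> nat" where "pfst z = fst (prod_decode z)"
definition psnd :: "nat \<Rightarrow> nat" where "psnd z = snd (prod_decode z)"

lemma pfst_encode [simp]: "pfst (prod_encode (x, y)) = x"
  and psnd_encode [simp]: "psnd (prod_encode (x, y)) = y"
  by (simp_all add: pfst_def psnd_def)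

lemma rec_eval_Id: "i < length xs \<Longrightarrow> v = xs ! i \<Longrightarrow> rec_eval (Id i) xs v"
  by (simp add: rec_eval.id)

lemma rec_eval_Cn1: "rec_eval g xs y \<Longrightarrow> rec_eval f [y] v \<Longrightarrow> rec_eval (Cn f [g]) xs v"
  by (rule rec_eval.cn[where ys = "[y]"]) auto

lemma rec_eval_Cn2:
  "rec_eval g xs y \<Longrightarrow> rec_eval h xs z \<Longrightarrow> rec_eval f [y, z] v \<Longrightarrow> rec_eval (Cn f [g, h]) xs v"
  by (rule rec_eval.cn[where ys = "[y, z]"]) (auto simp: less_Suc_eq)

lemma rec_eval_Pr:
  assumes "rec_eval f xs (F 0)" and "\<And>k. rec_eval g (k # F k # xs) (F (Suc k))"
  shows "rec_eval (Pr f g) (n # xs) (F n)"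
  by (induction n) (auto intro: rec_eval.pr0 rec_eval.prS assms)

lemma computable_id: "computable (\<lambda>x. x)"
  unfolding computable_def by (intro exI[of _ "Id 0"] allI rec_eval_Id) auto

lemma computable_Suc: "computable Suc"
  unfolding computable_def by (blast intro: rec_eval.s)

lemma computable_comp: "computable f \<Longrightarrow> computable g \<Longrightarrow> computable (\<lambda>x. f (g x))"
  unfolding computable_def by (blast intro: rec_eval_Cn1)

lemma computable2_comp:
  "computable2 h \<Longrightarrow> computable f \<Longrightarrow> computable g \<Longrightarrow> computable (\<lambda>x. h (f x) (g x))"
  unfolding computable_def computable2_def by (blast intro: rec_eval_Cn2)

lemma computable_const: "computable (\<lambda>x. c)"
proof (induction c)
  case 0
  then show ?case unfolding computable_def by (blast intro: rec_eval.z)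
next
  case (Suc c)
  then show ?case using computable_comp[OF computable_Suc] by blast
qed

lemma computable2_add: "computable2 (+)"
proof -
  have "rec_eval (Pr (Id 0) (Cn S [Id 1])) [x, y] (x + y)" for x y
    by (rule rec_eval_Pr) (auto intro!: rec_eval_Id rec_eval_Cn1 rec_eval.s)
  then show ?thesis unfolding computable2_def by blast
qed

lemma computable2_mult: "computable2 (*)"
proof -
  obtain a where a: "\<And>x y. rec_eval a [x, y] (x + y)"
    using computable2_add unfolding computable2_def by blast
  have "rec_eval (Pr Z (Cn a [Id 2, Id 1])) [x, y] (x * y)" for x y
    by (rule rec_eval_Pr) (auto intro!: rec_eval_Id rec_eval_Cn2 rec_eval.z a)
  then show ?thesis unfolding computable2_def by blast
qed

lemma computable2_diff: "computable2 (\<lambda>x y. x - y)"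
proof -
  \<comment> \<open>The predecessor is a recursion that returns its own counter.\<close>
  have pred: "rec_eval (Pr Z (Id 0)) [x] (x - 1)" for x
    by (rule rec_eval_Pr) (auto intro!: rec_eval_Id rec_eval.z)
  \<comment> \<open>\<open>Pr\<close> recurs on its first argument, so the subtrahend comes first
    here and the arguments are swapped afterwards.\<close>
  have "rec_eval (Pr (Id 0) (Cn (Pr Z (Id 0)) [Id 1])) [y, x] (x - y)" for x y
  proof (rule rec_eval_Pr)
    show "rec_eval (Cn (Pr Z (Id 0)) [Id 1]) [k, x - k, x] (x - Suc k)" for k
      using rec_eval_Cn1[OF rec_eval_Id pred, of 1 "[k, x - k, x]" "x - k"] by simp
  qed (auto intro!: rec_eval_Id)
  then have "rec_eval (Cn (Pr (Id 0) (Cn (Pr Z (Id 0)) [Id 1])) [Id 1, Id 0]) [x, y] (x - y)" for x y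
    by (auto intro!: rec_eval_Cn2 rec_eval_Id)
  then show ?thesis unfolding computable2_def by blast
qed

lemmas computable_basic = computable_id computable_const computable_comp[OF computable_Suc]
  computable2_comp[OF computable2_add] computable2_comp[OF computable2_mult]
  computable2_comp[OF computable2_diff]

section \<open>Computing the pairing function and its inverse\<close>

lemma computable_triangle: "computable triangle"
proof -
  obtain a where a: "\<And>x y. rec_eval a [x, y] (x + y)"
    using computable2_add unfolding computable2_def by blast
  have "rec_eval (Pr Z (Cn a [Id 1, Cn S [Id 0]])) [x] (triangle x)" for x
  proof (rule rec_eval_Pr)
    show "rec_eval (Cn a [Id 1, Cn S [Id 0]]) [k, triangle k] (triangle (Suc k))" for k
      unfolding triangle_Suc
      by (rule rec_eval_Cn2[OF rec_eval_Id rec_eval_Cn1[OF rec_eval_Id rec_eval.s] a]) auto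
  qed (auto intro!: rec_eval.z)
  then show ?thesis unfolding computable_def by blast
qed

lemma computable2_pair: "computable2 (\<lambda>x y. prod_encode (x, y))"
proof -
  obtain a where a: "\<And>x y. rec_eval a [x, y] (x + y)"
    using computable2_add unfolding computable2_def by blast
  obtain t where t: "\<And>x. rec_eval t [x] (triangle x)"
    using computable_triangle unfolding computable_def by blast
  have "rec_eval (Cn a [Cn t [a], Id 0]) [x, y] (prod_encode (x, y))" for x y
    by (auto intro!: rec_eval_Cn2[where y = "triangle (x + y)" and z = x]
        rec_eval_Cn1[where y = "x + y"] rec_eval_Id a t simp: prod_encode_def a)
  then show ?thesis unfolding computable2_def by blast
qed

text \<open>The diagonal of \<open>z\<close> in the pairing is the least \<open>s\<close> with \<open>z < triangle (Suc s)\<close>; an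
  unbounded search finds it before any decoding function is available.\<close>

definition diagonal :: "nat \<Rightarrow> nat" where "diagonal z = pfst z + psnd z"

lemma triangle_diagonal: "z = triangle (diagonal z) + pfst z"
proof -
  have "z = prod_encode (pfst z, psnd z)"
    by (simp add: pfst_def psnd_def)
  then show ?thesis
    by (simp only: prod_encode_def prod.case diagonal_def)
qed

lemma mono_triangle: "k \<le> l \<Longrightarrow> triangle k \<le> triangle l"
  by (rule lift_Suc_mono_le) simp_all

lemma computable_diagonal: "computable diagonal"
proof -
  obtain d where d: "\<And>x y. rec_eval d [x, y] (x - y)"
    using computable2_diff unfolding computable2_def by blast
  obtain t where t: "\<And>x. rec_eval t [x] (triangle x)"
    using computable_triangle unfolding computable_def by blast
  \<comment> \<open>By truncated subtraction this term is 0 exactly when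
    \<open>z < triangle (Suc k)\<close>, which is the test needed for \<open>Mn\<close>.\<close>
  let ?f = "Cn d [Cn S [Id 1], Cn t [Cn S [Id 0]]]"
  have f: "rec_eval ?f [k, z] (Suc z - triangle (Suc k))" for k z
    by (rule rec_eval_Cn2[OF _ _ d]) (auto intro!: rec_eval_Id rec_eval_Cn1 rec_eval.s t simp del: triangle_Suc)
  have "rec_eval (Mn ?f) [z] (diagonal z)" for z
  proof (rule rec_eval.mn)
    have "pfst z \<le> diagonal z"
      by (simp add: diagonal_def)
    then have "Suc z \<le> triangle (Suc (diagonal z))"
      using triangle_diagonal[of z] by simp
    then show "rec_eval ?f [diagonal z, z] 0"
      using f[of "diagonal z" z] by (simp del: triangle_Suc)
    show "\<forall>k<diagonal z. \<exists>v. rec_eval ?f [k, z] v \<and> 0 < v"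
    proof (intro allI impI exI conjI)
      fix k assume "k < diagonal z"
      then have "triangle (Suc k) \<le> triangle (diagonal z)"
        by (intro mono_triangle) simp
      then show "0 < Suc z - triangle (Suc k)"
        using triangle_diagonal[of z] by simp
    qed (rule f)
  qed
  then show ?thesis unfolding computable_def by blast
qed

lemma computable_pfst: "computable pfst"
proof -
  have eq: "pfst z = z - triangle (diagonal z)" for z
    using triangle_diagonal[of z] by linarith
  show ?thesis
    unfolding eq[abs_def] by (intro computable_basic computable_comp[OF computable_triangle] computable_diagonal)
qed

lemma computable_psnd: "computable psnd"
proof -
  have eq: "psnd z = diagonal z - pfst z" for z
    by (simp add: diagonal_def)
  show ?thesis
    unfolding eq[abs_def] by (intro computable_basic computable_diagonal computable_pfst)
qed

text \<open>The step function receives parameter, counter and previous value packed as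
  \<open>((x, n), y)\<close>; the second hypothesis is its computability as a function of that
  single number.\<close>

lemma computable_rec_nat:
  assumes "computable a" and "computable (\<lambda>z. h (pfst (pfst z)) (psnd (pfst z)) (psnd z))"
    and "computable b"
  shows "computable (\<lambda>x. rec_nat (a x) (\<lambda>n y. h x n y) (b x))"
proof -
  obtain A where A: "\<And>x. rec_eval A [x] (a x)"
    using assms(1) unfolding computable_def by blast
  obtain H where H: "\<And>z. rec_eval H [z] (h (pfst (pfst z)) (psnd (pfst z)) (psnd z))"
    using assms(2) unfolding computable_def by blast
  obtain B where B: "\<And>x. rec_eval B [x] (b x)"
    using assms(3) unfolding computable_def by blast
  obtain p where p: "\<And>x y. rec_eval p [x, y] (prod_encode (x, y))"
    using computable2_pair unfolding computable2_def by blast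
  let ?G = "Cn H [Cn p [Cn p [Id 2, Id 0], Id 1]]"
  have "rec_eval ?G [n, y, x] (h x n y)" for n y x
  proof (rule rec_eval_Cn1)
    show "rec_eval (Cn p [Cn p [Id 2, Id 0], Id 1]) [n, y, x] (prod_encode (prod_encode (x, n), y))"
      by (rule rec_eval_Cn2[OF rec_eval_Cn2[OF _ _ p] _ p]) (auto intro!: rec_eval_Id)
    show "rec_eval H [prod_encode (prod_encode (x, n), y)] (h x n y)"
      using H[of "prod_encode (prod_encode (x, n), y)"] by simp
  qed
  then have "rec_eval (Pr A ?G) [n, x] (rec_nat (a x) (\<lambda>n y. h x n y) n)" for n x
    by (intro rec_eval_Pr) (simp_all add: A)
  then have "rec_eval (Cn (Pr A ?G) [B, Id 0]) [x] (rec_nat (a x) (\<lambda>n y. h x n y) (b x))" for x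
    by (intro rec_eval_Cn2[OF B]) (auto intro!: rec_eval_Id)
  then show ?thesis
    unfolding computable_def by blast
qed

section \<open>Decidable predicates and bounded quantification\<close>

lemma computable_if:
  assumes "decidable P" "computable f" "computable g"
  shows "computable (\<lambda>x. if P x then f x else g x)"
proof -
  have eq: "(\<lambda>x. if P x then f x else g x) = (\<lambda>x. of_bool (P x) * f x + (1 - of_bool (P x)) * g x)"
    by auto
  show ?thesis
    unfolding eq by (intro computable_basic assms assms(1)[unfolded decidable_def])
qed

lemma decidable_le:
  assumes "computable f" "computable g"
  shows "decidable (\<lambda>x. f x \<le> g x)"
proof -
  have eq: "(\<lambda>x. of_bool (f x \<le> g x)) = (\<lambda>x. 1 - (f x - g x))"
    by auto
  show ?thesis
    unfolding decidable_def eq by (intro computable_basic assms)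
qed

lemma decidable_less:
  assumes "computable f" "computable g"
  shows "decidable (\<lambda>x. f x < g x)"
  using decidable_le[OF computable_comp[OF computable_Suc assms(1)] assms(2)]
  by (simp add: Suc_le_eq)

lemma decidable_not:
  assumes "decidable P"
  shows "decidable (\<lambda>x. \<not> P x)"
proof -
  have eq: "(\<lambda>x. of_bool (\<not> P x)) = (\<lambda>x. 1 - of_bool (P x) :: nat)"
    by auto
  show ?thesis
    unfolding decidable_def eq by (intro computable_basic assms[unfolded decidable_def])
qed

lemma decidable_conj:
  assumes "decidable P" "decidable Q"
  shows "decidable (\<lambda>x. P x \<and> Q x)"
  using computable2_comp[OF computable2_mult assms[unfolded decidable_def]]
  by (simp add: decidable_def of_bool_conj)

lemma decidable_disj:
  assumes "decidable P" "decidable Q"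
  shows "decidable (\<lambda>x. P x \<or> Q x)"
  using decidable_not[OF decidable_conj[OF decidable_not[OF assms(1)] decidable_not[OF assms(2)]]]
  by simp

lemma decidable_imp:
  assumes "decidable P" "decidable Q"
  shows "decidable (\<lambda>x. P x \<longrightarrow> Q x)"
  unfolding imp_conv_disj by (intro decidable_disj decidable_not assms)

lemma decidable_eq:
  assumes "computable f" "computable g"
  shows "decidable (\<lambda>x. f x = g x)"
  unfolding order_eq_iff by (intro decidable_conj decidable_le assms)

lemma decidable_if:
  assumes "decidable P" "decidable Q" "decidable R"
  shows "decidable (\<lambda>x. if P x then Q x else R x)"
  using computable_if[OF assms(1) assms(2,3)[unfolded decidable_def]]
  unfolding decidable_def by (simp add: if_distrib)

lemma decidable_bex:
  assumes "computable b" and "decidable (\<lambda>z. P (pfst z) (psnd z))"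
  shows "decidable (\<lambda>x. \<exists>y<b x. P x y)"
proof -
  let ?r = "\<lambda>x. rec_nat 0 (\<lambda>n y. if P x n then 1 else y)"
  have r: "?r x n = (of_bool (\<exists>y<n. P x y) :: nat)" for x n
    by (induction n) (auto simp: less_Suc_eq)
  \<comment> \<open>The step function sees a packed triple, and \<open>P\<close> concerns only its
    first component, the pair of parameter and counter.\<close>
  have "computable (\<lambda>z. of_bool (P (pfst (pfst z)) (psnd (pfst z))))"
    using computable_comp[OF assms(2)[unfolded decidable_def] computable_pfst] .
  then have "decidable (\<lambda>z. P (pfst (pfst z)) (psnd (pfst z)))"
    unfolding decidable_def .
  then have "computable (\<lambda>x. ?r x (b x))"
    by (intro computable_rec_nat computable_const assms(1) computable_if computable_psnd)
  then show ?thesis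
    unfolding decidable_def r .
qed

lemma decidable_ball:
  assumes "computable b" and "decidable (\<lambda>z. P (pfst z) (psnd z))"
  shows "decidable (\<lambda>x. \<forall>y<b x. P x y)"
  using decidable_not[OF decidable_bex[OF assms(1) decidable_not[OF assms(2)]]] by simp

lemma decidable_const: "decidable (\<lambda>x. b)"
  unfolding decidable_def by (rule computable_const)

lemma computable2_power: "computable2 (^)"
proof -
  have "rec_nat 1 (\<lambda>n y. x * y) k = x ^ k" for x k :: nat
    by (induction k) auto
  then have "computable (\<lambda>z. pfst z ^ psnd z)"
    using computable_rec_nat[of "\<lambda>_. 1" "\<lambda>z n y. pfst z * y" psnd]
    by (simp add: computable_basic computable_psnd computable_comp[OF computable_pfst] computable_pfst)
  then obtain r where r: "\<And>z. rec_eval r [z] (pfst z ^ psnd z)"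
    unfolding computable_def by blast
  obtain p where p: "\<And>x y. rec_eval p [x, y] (prod_encode (x, y))"
    using computable2_pair unfolding computable2_def by blast
  have "rec_eval (Cn r [p]) [x, y] (x ^ y)" for x y
    using rec_eval_Cn1[OF p r] by simp
  then show ?thesis
    unfolding computable2_def by blast
qed

text \<open>The iteration becomes stationary at the quotient, and \<open>f x\<close> steps are enough to reach it.\<close>

lemma computable_div:
  assumes "computable f" "computable g"
  shows "computable (\<lambda>x. f x div g x)"
proof -
  have it: "rec_nat 0 (\<lambda>n q. if 0 < b \<and> Suc q * b \<le> a then Suc q else q) k = min k (a div b)"
    for a b k :: nat
  proof (induction k)
    case (Suc k)
    show ?case
    \<comment> \<open>For \<open>b = 0\<close> the guard keeps the iterate at 0, in agreement with
      the convention \<open>a div 0 = 0\<close>.\<close>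
    proof (cases "b = 0")
      case False
      then have "Suc q * b \<le> a \<longleftrightarrow> Suc q \<le> a div b" for q
        using less_eq_div_iff_mult_less_eq[of b "Suc q" a] by simp
      with Suc False show ?thesis
        by (simp add: min_def del: mult_Suc)
    qed (use Suc in simp)
  qed simp
  have "computable (\<lambda>x. rec_nat 0 (\<lambda>n q. if 0 < g x \<and> Suc q * g x \<le> f x then Suc q else q) (f x))"
    by (intro computable_rec_nat computable_basic computable_if decidable_conj decidable_less
        decidable_le computable_comp[OF assms(1)] computable_comp[OF assms(2)] assms computable_psnd
        computable_comp[OF computable_pfst] computable_pfst)
  moreover have "min a (a div b) = a div b" for a b :: nat
    by (rule min_absorb2) (rule div_le_dividend)
  ultimately show ?thesis
    unfolding it by simp
qed

lemma computable_mod: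
  assumes "computable f" "computable g"
  shows "computable (\<lambda>x. f x mod g x)"
  unfolding modulo_nat_def
  by (intro computable_basic computable_div assms)

lemmas computable_intros = computable_basic computable2_comp[OF computable2_power]
  computable2_comp[OF computable2_pair] computable_comp[OF computable_pfst]
  computable_comp[OF computable_psnd] computable_div computable_mod computable_if
  decidable_le decidable_less decidable_eq decidable_const decidable_not decidable_conj
  decidable_disj decidable_imp decidable_if decidable_bex decidable_ball

section \<open>Profiles\<close>

definition edge :: "(nat \<Rightarrow> nat) \<Rightarrow> (nat \<Rightarrow> nat) \<Rightarrow> nat \<Rightarrow> nat \<times> nat \<times> nat" where
  "edge w q k = (q k, w k, q (Suc k))"

text \<open>Profiles range over all edges on \<open>M\<close> states, so that the same profile serves both automata;
  an edge missing in one of them gets weight \<open>-\<infinity>\<close> there.\<close>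

type_synonym profile = "(nat \<times> nat \<times> (nat \<times> nat \<times> nat) set) set"

text \<open>A path is a total function on absolute positions, although only its values from
  \<open>i\<close> to \<open>j\<close> matter; adjacent segments can then be glued without
  reindexing.\<close>

definition prof :: "nat \<Rightarrow> (nat \<Rightarrow> nat) \<Rightarrow> nat \<Rightarrow> nat \<Rightarrow> profile" where
  "prof M w i j = {(q i, q j, edge w q ` {i..<j}) | q. \<forall>k. q k < M}"

definition prof_mult :: "profile \<Rightarrow> profile \<Rightarrow> profile" where
  "prof_mult s t = {(p, r, X \<union> Y) | p q r X Y. (p, q, X) \<in> s \<and> (q, r, Y) \<in> t}"

lemma prof_iff: "(p, r, X) \<in> prof M w i j \<longleftrightarrow>
    (\<exists>q. (\<forall>k. q k < M) \<and> p = q i \<and> r = q j \<and> X = edge w q ` {i..<j})"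
  by (auto simp: prof_def)

lemma prof_glue:
  assumes "i \<le> j" "j \<le> k" "\<forall>l. q l < M" "\<forall>l. q' l < M" "q j = q' j"
  obtains r where "\<forall>l. r l < M" "r i = q i" "r j = q j" "r k = q' k"
    "edge w r ` {i..<j} = edge w q ` {i..<j}" "edge w r ` {j..<k} = edge w q' ` {j..<k}"
proof
  let ?r = "\<lambda>l. if l < j then q l else q' l"
  show "\<forall>l. ?r l < M" "?r i = q i" "?r j = q j" "?r k = q' k"
    using assms by auto
  \<comment> \<open>The last edge of the first segment ends at \<open>j\<close>, where
    \<open>?r\<close> already follows \<open>q'\<close>; the two paths agree there.\<close>
  have "edge w ?r l = edge w q l" if "l \<in> {i..<j}" for l
    using that assms(5) by (cases "Suc l = j") (auto simp: edge_def)
  then show "edge w ?r ` {i..<j} = edge w q ` {i..<j}"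
    by (intro image_cong refl)
  show "edge w ?r ` {j..<k} = edge w q' ` {j..<k}"
    by (intro image_cong refl) (auto simp: edge_def)
qed

text \<open>A path over the whole segment restricts to both halves, and two paths that meet at
  \<open>j\<close> are glued there. This makes profiles of factors multiply.\<close>

lemma prof_split:
  assumes "i \<le> j" "j \<le> k"
  shows "prof M w i k = prof_mult (prof M w i j) (prof M w j k)"
proof -
  have ivl: "{i..<k} = {i..<j} \<union> {j..<k}"
    using assms by auto
  show ?thesis
  proof (intro set_eqI iffI; clarsimp simp only: split_paired_all)
    fix p r X
    assume "(p, r, X) \<in> prof M w i k"
    then show "(p, r, X) \<in> prof_mult (prof M w i j) (prof M w j k)"
      unfolding prof_mult_def prof_def by (simp add: ivl image_Un) blast
  next
    fix p r X
    assume "(p, r, X) \<in> prof_mult (prof M w i j) (prof M w j k)"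
    then obtain q q' where "\<forall>l. q l < M" "\<forall>l. q' l < M" "q j = q' j" "p = q i" "r = q' k"
      and X: "X = edge w q ` {i..<j} \<union> edge w q' ` {j..<k}"
      unfolding prof_mult_def prof_def by auto
    with prof_glue[OF assms this(1-3)] show "(p, r, X) \<in> prof M w i k"
      unfolding prof_iff ivl image_Un by metis
  qed
qed

lemma prof_shift:
  assumes "\<And>k. k < l \<Longrightarrow> w (i + k) = w' (i' + k)"
  shows "prof M w i (i + l) = prof M w' i' (i' + l)"
proof -
  have sub: "prof M w i (i + l) \<subseteq> prof M w' i' (i' + l)"
    if eq: "\<And>k. k < l \<Longrightarrow> w (i + k) = w' (i' + k)" for w w' i i'
  proof clarify
    fix p r X
    assume "(p, r, X) \<in> prof M w i (i + l)"
    then obtain q where q: "\<forall>k. q k < M" "p = q i" "r = q (i + l)" "X = edge w q ` {i..<i + l}"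
      unfolding prof_iff by blast
    \<comment> \<open>The path is translated. Truncated subtraction distorts it only below
      \<open>i'\<close>, outside the segment.\<close>
    let ?q = "\<lambda>k. q (k - i' + i)"
    have "edge w q ` {i..<i + l} = edge w' ?q ` {i'..<i' + l}"
    proof -
      have "edge w q (i + k) = edge w' ?q (i' + k)" if "k < l" for k
        using eq[OF that] by (simp add: edge_def add.commute)
      then have "(\<lambda>k. edge w q (i + k)) ` {0..<l} = (\<lambda>k. edge w' ?q (i' + k)) ` {0..<l}"
        by (intro image_cong) auto
      moreover have "{a..<a + l} = (+) a ` {0..<l}" for a :: nat
        by (simp add: add.commute)
      ultimately show ?thesis
        by (simp only: image_image)
    qed
    then show "(p, r, X) \<in> prof M w' i' (i' + l)"
      unfolding prof_iff using q by (intro exI[of _ ?q]) (auto simp: add.commute)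
  qed
  show ?thesis
    using sub[of w i w' i'] sub[of w' i' w i] assms by auto
qed

lemma prof_cong:
  assumes "\<And>k. i \<le> k \<Longrightarrow> k < j \<Longrightarrow> w k = w' k" "i \<le> j"
  shows "prof M w i j = prof M w' i j"
  using prof_shift[of "j - i" w i w' i M] assms by simp

definition prof_space :: "nat \<Rightarrow> nat \<Rightarrow> profile set" where
  "prof_space m M = Pow ({..<M} \<times> {..<M} \<times> Pow ({..<M} \<times> {..<m} \<times> {..<M}))"

lemma prof_in_space:
  assumes "\<And>k. w k < m"
  shows "prof M w i j \<in> prof_space m M"
  unfolding prof_space_def prof_def edge_def using assms by auto

lemma finite_prof_space: "finite (prof_space m M)"
  unfolding prof_space_def by auto

lemma card_prof_space: "card (prof_space m M) = 2 ^ (M * M * 2 ^ (M * m * M))"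
  unfolding prof_space_def
  by (subst card_Pow) (auto simp: card_cartesian_product card_Pow mult.assoc)

text \<open>Two prefixes with equal profile allow the part between them to be cut out.\<close>

lemma short_representative:
  assumes "\<And>k. w k < m"
  shows "\<exists>v l'. (\<forall>k. v k < m) \<and> l' \<le> card (prof_space m M) \<and> (0 < l \<longrightarrow> 0 < l') \<and>
    prof M v 0 l' = prof M w 0 l"
  using assms
proof (induction l arbitrary: w rule: less_induct)
  case (less l)
  show ?case
  proof (cases "l \<le> card (prof_space m M)")
    case False
    \<comment> \<open>Prefix lengths start at 1, so that cutting never leaves the empty word; this
      gives the clause \<open>0 < l'\<close>.\<close>
    have "prof M w 0 ` {1..l} \<subseteq> prof_space m M"
      using prof_in_space less.prems by blast
    then have "card (prof M w 0 ` {1..l}) \<le> card (prof_space m M)"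
      by (rule card_mono[OF finite_prof_space])
    with False have "\<not> inj_on (prof M w 0) {1..l}"
      using card_image by fastforce
    then obtain a b where ab: "1 \<le> a" "a < b" "b \<le> l" "prof M w 0 a = prof M w 0 b"
      unfolding inj_on_def by (metis atLeastAtMost_iff linorder_neqE_nat)
    let ?v = "\<lambda>k. if k < a then w k else w (k + (b - a))"
    have "prof M ?v a (a + (l - b)) = prof M w b (b + (l - b))"
      by (rule prof_shift) (use ab in \<open>simp add: algebra_simps\<close>)
    moreover have "prof M ?v 0 a = prof M w 0 b"
      unfolding ab(4)[symmetric] by (rule prof_cong) auto
    ultimately have "prof M ?v 0 (a + (l - b)) = prof M w 0 l"
      using ab prof_split[of 0 a "a + (l - b)" M ?v] prof_split[of 0 b l M w] by simp
    moreover have "a + (l - b) < l" "0 < a + (l - b)"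
      using ab by auto
    moreover have "?v k < m" for k
      using less.prems by simp
    ultimately show ?thesis
      using less.IH[of "a + (l - b)" ?v] by (simp only:) blast
  qed (use less.prems in blast)
qed

section \<open>Ramsey factorization of infinite words\<close>

lemma Ramsey_nat_pairs:
  fixes P :: "nat \<Rightarrow> nat \<Rightarrow> 'c"
  assumes "finite C" "\<And>i j. P i j \<in> C"
  obtains h :: "nat \<Rightarrow> nat" and e where "strict_mono h" "\<And>i j. i < j \<Longrightarrow> P (h i) (h j) = e"
proof -
  obtain g :: "'c \<Rightarrow> nat" and n where g: "g ` C = {i. i < n}" "inj_on g C"
    using finite_imp_inj_to_nat_seg[OF assms(1)] by auto
  \<comment> \<open>\<open>Ramsey2\<close> colors unordered pairs by numbers: \<open>Min\<close> and
    \<open>Max\<close> recover the order of the two positions, and \<open>g\<close> numbers the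
    colors.\<close>
  let ?f = "\<lambda>X. g (P (Min X) (Max X))"
  have "g (P i j) < n" for i j
    using g(1) assms(2)[of i j] by auto
  then have "\<exists>Y t. Y \<subseteq> UNIV \<and> infinite Y \<and> t < n \<and>
      (\<forall>x\<in>Y. \<forall>y\<in>Y. x \<noteq> y \<longrightarrow> ?f {x, y} = t)"
    by (intro Ramsey2 infinite_UNIV_nat) simp
  then obtain Y t where Y: "infinite Y"
    and t: "\<And>x y. x \<in> Y \<Longrightarrow> y \<in> Y \<Longrightarrow> x \<noteq> y \<Longrightarrow> ?f {x, y} = t"
    by metis
  let ?h = "enumerate Y"
  have mono: "strict_mono ?h"
    using Y by (rule strict_mono_enumerate)
  have "P (?h i) (?h j) = the_inv_into C g t" if "i < j" for i j
  proof -
    have "?h i < ?h j"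
      using mono that by (rule strict_monoD)
    then have "?h i \<noteq> ?h j" "Min {?h i, ?h j} = ?h i" "Max {?h i, ?h j} = ?h j"
      by (auto simp: min_def max_def)
    then have "g (P (?h i) (?h j)) = t"
      using t[OF enumerate_in_set[OF Y, of i] enumerate_in_set[OF Y, of j]] by simp
    then show ?thesis
      using the_inv_into_f_f[OF g(2) assms(2)] by metis
  qed
  with mono show thesis
    by (rule that)
qed

text \<open>Since \<open>e\<close> is the profile between any two cuts, not just consecutive ones,
  and \<open>s\<close> the one before every cut, \<open>prof_split\<close> yields
  \<open>e e = e\<close> and \<open>s e = s\<close>.\<close>

definition ramsey_split :: "nat \<Rightarrow> (nat \<Rightarrow> nat) \<Rightarrow> (nat \<Rightarrow> nat) \<Rightarrow> profile \<Rightarrow> profile \<Rightarrow> bool" where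
  "ramsey_split M w h s e \<longleftrightarrow> strict_mono h \<and> (\<forall>i. prof M w 0 (h i) = s) \<and>
     (\<forall>i j. i < j \<longrightarrow> prof M w (h i) (h j) = e)"

text \<open>Ramsey's theorem makes the blocks uniform but not the prefixes. The prefix up to
  \<open>h 1\<close> has absorbed one factor \<open>e\<close> and is unchanged by further ones, so
  dropping the first cut makes all prefixes agree.\<close>

lemma ramsey_split_exists:
  assumes "\<And>k. w k < m"
  obtains h s e where "ramsey_split M w h s e"
proof -
  obtain h :: "nat \<Rightarrow> nat" and e where h: "strict_mono h" and e: "\<And>i j. i < j \<Longrightarrow> prof M w (h i) (h j) = e"
    using finite_prof_space[of m M] prof_in_space[of w m M, OF assms] 
    by (rule Ramsey_nat_pairs[of "prof_space m M" "prof M w"]) (rule that)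
  have le: "h i \<le> h j" if "i \<le> j" for i j
    using that by (rule monoD[OF strict_mono_mono[OF h]])
  have idem: "prof_mult e e = e"
    using prof_split[OF le[of 0 1] le[of 1 2], of M w] e by simp
  have suc: "prof M w 0 (h (Suc i)) = prof_mult (prof M w 0 (h i)) e" for i
    using prof_split[OF _ le[of i "Suc i"], of 0 M w] e[of i "Suc i"] by simp
  \<comment> \<open>The prefix up to \<open>h 2\<close> is split once at \<open>h 0\<close> and once
    at \<open>h 1\<close>; comparing both factorizations gives the required instance of
    associativity.\<close>
  have "prof_mult (prof_mult (prof M w 0 (h 0)) e) e = prof_mult (prof M w 0 (h 0)) e"
    using prof_split[OF _ le[of 0 2], of 0 M w] suc[of 0] suc[of 1] e[of 0 2]
    by (simp add: numeral_2_eq_2)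
  then have "prof M w 0 (h (Suc i)) = prof M w 0 (h 1)" for i
    by (induction i) (simp_all add: suc)
  then have "ramsey_split M w (\<lambda>i. h (Suc i)) (prof M w 0 (h 1)) e"
    unfolding ramsey_split_def using h e by (auto simp: strict_mono_def)
  then show thesis
    by (rule that)
qed

text \<open>The hypotheses say \<open>s e = s\<close> and \<open>e e = e\<close>, so repeating the
  factor between \<open>i\<close> and \<open>j\<close> forever creates no new profile. The stretch
  from \<open>j\<close> to \<open>k\<close> is present as the second factor of the idempotence
  law.\<close>

lemma ramsey_split_periodic:
  assumes ij: "i < j" and jk: "j < k"
    and s: "prof M w 0 j = prof M w 0 i"
    and e: "prof M w j k = prof M w i j" "prof M w i k = prof M w i j"
  defines "v \<equiv> \<lambda>l. if l < i then w l else w (i + (l - i) mod (j - i))"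
  shows "ramsey_split M v (\<lambda>l. i + l * (j - i)) (prof M w 0 i) (prof M w i j)"
proof -
  let ?p = "j - i"
  let ?h = "\<lambda>l. i + l * ?p"
  let ?e = "prof M w i j"
  have idem: "prof_mult ?e ?e = ?e"
    using prof_split[of i j k M w] ij jk e by simp
  have abs: "prof_mult (prof M w 0 i) ?e = prof M w 0 i"
    using prof_split[of 0 i j M w] ij s by simp
  have mono: "?h a \<le> ?h b" if "a \<le> b" for a b
    using that by simp
  have step: "prof M v (?h l) (?h (Suc l)) = ?e" for l
  proof -
    have "prof M v (?h l) (?h l + ?p) = prof M w i (i + ?p)"
      by (rule prof_shift) (simp add: v_def)
    moreover have "?h l + ?p = ?h (Suc l)" "i + ?p = j"
      using ij by simp_all
    ultimately show ?thesis
      by (simp only:)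
  qed
  have "prof M v (?h a) (?h (Suc (a + d))) = ?e" for a d
  proof (induction d)
    case (Suc d)
    show ?case
      using prof_split[OF mono mono, of a "Suc (a + d)" "Suc (a + Suc d)" M v]
        Suc step[of "Suc (a + d)"] idem by (simp only: add_Suc_right le_add1 le_SucI le_refl)
  qed (use step in simp)
  then have "prof M v (?h a) (?h b) = ?e" if "a < b" for a b
    using that by (metis less_imp_Suc_add)
  moreover have "prof M v 0 (?h l) = prof M w 0 i" for l
  proof (induction l)
    case 0
    show ?case
      using prof_cong[of 0 i v w M] by (simp add: v_def)
  next
    case (Suc l)
    then show ?case
      using prof_split[of 0 "?h l" "?h (Suc l)" M v] step[of l] abs by simp
  qed
  moreover have "strict_mono ?h"
    using ij by (auto simp: strict_mono_def)
  ultimately show ?thesis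
    unfolding ramsey_split_def by blast
qed

section \<open>Behavior on words split by Ramsey's theorem\<close>

definition inf_often :: "(nat \<Rightarrow> 'a) \<Rightarrow> 'a set" where
  "inf_often d = {x. \<exists>\<^sub>\<infinity>i. d i = x}"

lemma inf_often_tail:
  assumes "finite (range d)"
  obtains N where "\<And>i. N \<le> i \<Longrightarrow> d i \<in> inf_often d"
proof -
  have "\<forall>x\<in>range d - inf_often d. \<forall>\<^sub>\<infinity>i. d i \<noteq> x"
    by (simp add: inf_often_def not_frequently)
  then have "\<forall>\<^sub>\<infinity>i. \<forall>x\<in>range d - inf_often d. d i \<noteq> x"
    using assms by (intro eventually_ball_finite) auto
  then obtain N where "\<And>i. N \<le> i \<Longrightarrow> \<forall>x\<in>range d - inf_often d. d i \<noteq> x"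
    unfolding MOST_nat_le by blast
  then show thesis
    using that by (metis DiffI rangeI)
qed

lemma inf_often_later: "x \<in> inf_often d \<Longrightarrow> \<exists>i\<ge>n. d i = x"
  by (auto simp: inf_often_def INFM_nat_le)

lemma inf_often_subset: "inf_often d \<subseteq> range d"
  using inf_often_later[of _ d 0] by auto

lemma inf_oftenI: "(\<And>n. \<exists>i\<ge>n. d i = x) \<Longrightarrow> x \<in> inf_often d"
  by (auto simp: inf_often_def INFM_nat_le)

text \<open>Finiteness excludes that \<open>g\<close> merges infinitely many values, each of them
  taken only finitely often. This carries recurrence from edges over to their weights and source
  states.\<close>

lemma inf_often_image:
  assumes "finite (range d)"
  shows "inf_often (\<lambda>i. g (d i)) = g ` inf_often d"
proof
  show "g ` inf_often d \<subseteq> inf_often (\<lambda>i. g (d i))"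
    by (auto intro!: inf_oftenI dest!: inf_often_later)
  show "inf_often (\<lambda>i. g (d i)) \<subseteq> g ` inf_often d"
  proof
    fix c assume c: "c \<in> inf_often (\<lambda>i. g (d i))"
    obtain N where N: "\<And>i. N \<le> i \<Longrightarrow> d i \<in> inf_often d"
      using inf_often_tail[OF assms] by blast
    from inf_often_later[OF c, of N] N show "c \<in> g ` inf_often d"
      by blast
  qed
qed

text \<open>The argument \<open>Y\<close> is the set of values taken infinitely often; the value \<open>-\<infinity>\<close> is
  not treated specially and has to be excluded separately.\<close>

definition set_val :: "valmonoid \<Rightarrow> ereal set \<Rightarrow> ereal set \<Rightarrow> ereal" where
  "set_val K X Y = (if X \<subseteq> {\<infinity>} then \<infinity> else
     (case K of
        K1 \<Rightarrow> Inf ((if Y \<subseteq> {\<infinity>} then X else Y) - {\<infinity>})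
      | K2 \<Rightarrow> Sup ((if Y \<subseteq> {\<infinity>} then X else Y) - {\<infinity>})
      | K3 \<Rightarrow> Sup (X - {\<infinity>})))"

text \<open>From some \<open>N\<close> on only recurring values occur, and each of them occurs after
  every position. Hence the value sets of the tails are constant from \<open>N\<close> on, and the
  outer supremum or infimum is attained there.\<close>

lemma val_eq_set_val:
  assumes fin: "finite (range d)" and no: "-\<infinity> \<notin> range d"
  shows "val K d = set_val K (range d) (inf_often d)"
proof (cases "\<forall>i. d i = \<infinity>")
  case True
  then show ?thesis
    using no by (auto simp: val_def set_val_def)
next
  case False
  let ?I = "inf_often d"
  let ?T = "\<lambda>i. {k. i \<le> k \<and> d k \<noteq> \<infinity>}"
  obtain N where N: "\<And>i. N \<le> i \<Longrightarrow> d i \<in> ?I"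
    using inf_often_tail[OF fin] by blast
  have T_N: "d ` ?T i = ?I - {\<infinity>}" if "N \<le> i" for i
    using N that by (auto dest: inf_often_later[of _ d i])
  have T_sup: "?I - {\<infinity>} \<subseteq> d ` ?T i" for i
    by (auto dest: inf_often_later[of _ d i])
  have inf: "infinite {i. d i \<noteq> \<infinity>} \<longleftrightarrow> \<not> ?I \<subseteq> {\<infinity>}"
  proof
    assume "infinite {i. d i \<noteq> \<infinity>}"
    then obtain i where "N \<le> i" "d i \<noteq> \<infinity>"
      unfolding infinite_nat_iff_unbounded_le by auto
    then show "\<not> ?I \<subseteq> {\<infinity>}"
      using N by auto
  next
    assume "\<not> ?I \<subseteq> {\<infinity>}"
    then obtain x where "x \<in> ?I" "x \<noteq> \<infinity>"
      by auto
    then show "infinite {i. d i \<noteq> \<infinity>}"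
      unfolding infinite_nat_iff_unbounded_le by (auto dest: inf_often_later)
  qed
  have "(SUP i. INF k\<in>?T i. d k) = Inf (?I - {\<infinity>})"
  proof (rule antisym)
    show "(SUP i. INF k\<in>?T i. d k) \<le> Inf (?I - {\<infinity>})"
      by (rule SUP_least) (rule Inf_superset_mono[OF T_sup])
    show "Inf (?I - {\<infinity>}) \<le> (SUP i. INF k\<in>?T i. d k)"
      unfolding T_N[of N, OF order_refl, symmetric] by (rule SUP_upper) simp
  qed
  moreover have "(INF i. SUP k\<in>?T i. d k) = Sup (?I - {\<infinity>})"
  proof (rule antisym)
    show "Sup (?I - {\<infinity>}) \<le> (INF i. SUP k\<in>?T i. d k)"
      by (rule INF_greatest) (rule Sup_subset_mono[OF T_sup])
    show "(INF i. SUP k\<in>?T i. d k) \<le> Sup (?I - {\<infinity>})"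
      unfolding T_N[of N, OF order_refl, symmetric] by (rule INF_lower) simp
  qed
  moreover have "d ` {i. d i \<noteq> \<infinity>} = range d - {\<infinity>}"
    by auto
  moreover have "\<not> (\<exists>i. d i = -\<infinity>)"
    using no by (metis rangeI)
  moreover have "\<not> range d \<subseteq> {\<infinity>}"
    using False by auto
  ultimately show ?thesis
    unfolding val_def set_val_def inf if_not_P[OF False] by (simp split: valmonoid.split)
qed

section \<open>Runs and lassos\<close>

definition runs :: "nat \<Rightarrow> (nat \<Rightarrow> nat) \<Rightarrow> (nat \<times> (nat \<times> nat \<times> nat) set \<times> (nat \<times> nat \<times> nat) set) set" where
  "runs M w = {(q 0, range (edge w q), inf_often (edge w q)) | q. \<forall>k. q k < M}"

text \<open>The stem leads to \<open>q\<close> along \<open>X\<close>, and a cycle at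
  \<open>q\<close> along \<open>Y\<close> is repeated forever: all edges of
  \<open>X \<union> Y\<close> are used, those of \<open>Y\<close> infinitely often.\<close>

definition lassos :: "profile \<Rightarrow> profile \<Rightarrow> (nat \<times> (nat \<times> nat \<times> nat) set \<times> (nat \<times> nat \<times> nat) set) set" where
  "lassos s e = {(p, X \<union> Y, Y) | p q X Y. (p, q, X) \<in> s \<and> (q, q, Y) \<in> e}"

lemma finite_range_edge:
  assumes "\<And>k. w k < m" "\<And>k. q k < M"
  shows "finite (range (edge w q))"
  by (rule finite_subset[of _ "{..<M} \<times> {..<m} \<times> {..<M}"]) (auto simp: edge_def assms)

text \<open>Pick a cut \<open>h i\<close> after which only recurring edges occur and whose state
  recurs at cuts, then a later cut \<open>h j\<close> with the same state such that all recurring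
  edges occur in between. The cycle may span many blocks; its profile is still \<open>e\<close> by
  the uniformity over all pairs of cuts.\<close>

lemma runs_subset_lassos:
  assumes split: "ramsey_split M w h s e" and w: "\<And>k. w k < m"
  shows "runs M w \<subseteq> lassos s e"
proof
  have h: "strict_mono h" and s: "\<And>i. prof M w 0 (h i) = s"
    and e: "\<And>i j. i < j \<Longrightarrow> prof M w (h i) (h j) = e"
    using split by (auto simp: ramsey_split_def)
  fix t assume "t \<in> runs M w"
  then obtain q where q: "\<And>k. q k < M"
    and t: "t = (q 0, range (edge w q), inf_often (edge w q))"
    by (auto simp: runs_def)
  let ?d = "edge w q"
  have fin: "finite (range ?d)"
    using w q by (rule finite_range_edge)
  obtain N where N: "\<And>i. N \<le> i \<Longrightarrow> ?d i \<in> inf_often ?d"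
    using inf_often_tail[OF fin] by blast
  have "finite (range (\<lambda>i. q (h i)))"
    by (rule finite_subset[of _ "{..<M}"]) (use q in auto)
  then obtain N' where N': "\<And>i. N' \<le> i \<Longrightarrow> q (h i) \<in> inf_often (\<lambda>i. q (h i))"
    using inf_often_tail[of "\<lambda>i. q (h i)"] by blast
  define i where "i = max N N'"
  have hi: "k \<le> h k" for k
    using h by (rule strict_mono_imp_increasing)
  have "\<forall>x\<in>inf_often ?d. \<exists>k\<ge>h i. ?d k = x"
    using inf_often_later by metis
  then obtain f where f: "\<And>x. x \<in> inf_often ?d \<Longrightarrow> h i \<le> f x \<and> ?d (f x) = x"
    by metis
  have fin_I: "finite (inf_often ?d)"
    by (rule finite_subset[OF inf_often_subset fin])
  \<comment> \<open>\<open>f\<close> picks an occurrence of each recurring edge. As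
    \<open>j \<le> h j\<close>, it suffices that the index \<open>j\<close> exceeds all these
    positions; \<open>insert 0\<close> makes \<open>Max\<close> meaningful without a nonemptiness
    argument.\<close>
  obtain j where j: "Suc (max i (Max (insert 0 (f ` inf_often ?d)))) \<le> j" "q (h j) = q (h i)"
    using inf_often_later[OF N'[of i]] by (auto simp: i_def)
  have ij: "i < j"
    using j(1) by auto
  have f_lt: "f x < h j" if "x \<in> inf_often ?d" for x
  proof -
    have "f x \<le> Max (insert 0 (f ` inf_often ?d))"
      using fin_I that by (intro Max_ge) auto
    also have "\<dots> < j"
      using j(1) by auto
    finally show ?thesis
      using hi[of j] by simp
  qed
  have big: "N \<le> h i"
    using hi[of i] by (simp add: i_def)
  have Y: "?d ` {h i..<h j} = inf_often ?d"
  proof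
    show "?d ` {h i..<h j} \<subseteq> inf_often ?d"
      using N big by auto
    show "inf_often ?d \<subseteq> ?d ` {h i..<h j}"
    proof
      fix x assume x: "x \<in> inf_often ?d"
      show "x \<in> ?d ` {h i..<h j}"
        using f[OF x] f_lt[OF x] by (intro image_eqI[of _ _ "f x"]) auto
    qed
  qed
  have X: "range ?d = ?d ` {0..<h i} \<union> inf_often ?d"
  proof
    show "range ?d \<subseteq> ?d ` {0..<h i} \<union> inf_often ?d"
    proof
      fix x assume "x \<in> range ?d"
      then obtain k where x: "x = ?d k"
        by blast
      show "x \<in> ?d ` {0..<h i} \<union> inf_often ?d"
        unfolding x using N[of k] big by (cases "k < h i") auto
    qed
  qed (use inf_often_subset[of ?d] in blast)
  have "(q 0, q (h i), ?d ` {0..<h i}) \<in> s"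
    unfolding s[of i, symmetric] prof_iff using q by blast
  moreover have "(q (h i), q (h i), inf_often ?d) \<in> e"
    unfolding e[OF ij, symmetric] prof_iff using q j(2) Y by metis
  ultimately show "t \<in> lassos s e"
    unfolding lassos_def t using X by auto
qed

text \<open>Every block between consecutive cuts has profile \<open>e\<close> and so admits its own
  path from \<open>p\<close> to \<open>p\<close> with edge set \<open>Y\<close>; these paths are
  chained after the stem.\<close>

lemma lassos_subset_runs:
  assumes split: "ramsey_split M w h s e"
  shows "lassos s e \<subseteq> runs M w"
proof
  have h: "strict_mono h" and s: "\<And>i. prof M w 0 (h i) = s"
    and e: "\<And>i. prof M w (h i) (h (Suc i)) = e"
    using split by (auto simp: ramsey_split_def)
  have h_lt: "h l < h (Suc l)" for l
    using h by (simp add: strict_mono_Suc_iff)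
  fix t assume "t \<in> lassos s e"
  then obtain p0 p X Y where X: "(p0, p, X) \<in> s" and Y: "(p, p, Y) \<in> e"
    and t: "t = (p0, X \<union> Y, Y)"
    by (auto simp: lassos_def)
  obtain r0 where r0: "\<And>k. r0 k < M" "p0 = r0 0" "p = r0 (h 0)" "X = edge w r0 ` {0..<h 0}"
    using X unfolding s[of 0, symmetric] prof_iff by blast
  have "\<forall>l. \<exists>r. (\<forall>k. r k < M) \<and> p = r (h l) \<and> p = r (h (Suc l)) \<and>
      Y = edge w r ` {h l..<h (Suc l)}"
    using Y e unfolding prof_iff[symmetric] by blast
  then obtain r where r: "\<And>l k. r l k < M" "\<And>l. p = r l (h l)" "\<And>l. p = r l (h (Suc l))"
    and r_Y: "\<And>l. Y = edge w (r l) ` {h l..<h (Suc l)}"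
    by metis
  \<comment> \<open>For a position from \<open>h 0\<close> on, this is the number of its
    block.\<close>
  let ?idx = "\<lambda>k. LEAST l. k < h (Suc l)"
  let ?q = "\<lambda>k. if k < h 0 then r0 k else r (?idx k) k"
  have idx: "?idx k = l" if "h l \<le> k" "k < h (Suc l)" for k l
  proof (rule Least_equality)
    fix l' assume "k < h (Suc l')"
    then have "h l < h (Suc l')"
      using that by simp
    then show "l \<le> l'"
      using h by (simp add: strict_mono_less)
  qed (rule that)
  have le0: "h 0 \<le> h l" for l
    using h by (simp add: strict_mono_less_eq)
  \<comment> \<open>The right end is included because the last edge of a block ends there; the index
    has already moved to the next block, but both paths are in state \<open>p\<close>.\<close>
  have q_seg: "?q k = r l k" if "h l \<le> k" "k \<le> h (Suc l)" for l k
  proof (cases "k = h (Suc l)")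
    case True
    then have "?idx k = Suc l"
      using h_lt by (intro idx) auto
    then show ?thesis
      using True le0[of "Suc l"] r(2)[of "Suc l"] r(3)[of l] by simp
  next
    case False
    then show ?thesis
      using that le0[of l] idx[of l k] by simp
  qed
  have q0: "?q k = r0 k" if "k \<le> h 0" for k
    using that q_seg[of 0 "h 0"] r0(3) r(2)[of 0] h_lt[of 0] by (cases "k = h 0") auto
  have seg_Y: "edge w ?q ` {h l..<h (Suc l)} = Y" for l
    unfolding r_Y[of l] by (intro image_cong refl) (simp add: edge_def q_seg)
  have seg_X: "edge w ?q ` {0..<h 0} = X"
    unfolding r0(4) by (intro image_cong refl) (simp add: edge_def q0)
  have cover: "\<exists>l. h l \<le> k \<and> k < h (Suc l)" if "h 0 \<le> k" for k
    using that
  proof (induction k rule: dec_induct)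
    case base
    then show ?case using h_lt by blast
  next
    case (step k)
    then obtain l where "h l \<le> k" "k < h (Suc l)"
      by blast
    then show ?case
      using h_lt[of "Suc l"] by (cases "Suc k < h (Suc l)") (auto intro: exI[of _ l] exI[of _ "Suc l"])
  qed
  have later: "edge w ?q k \<in> Y" if k: "h 0 \<le> k" for k
  proof -
    obtain l where "h l \<le> k" "k < h (Suc l)"
      using cover[OF k] by blast
    then show ?thesis
      unfolding seg_Y[of l, symmetric] by (intro imageI) simp
  qed
  have "inf_often (edge w ?q) = Y"
  proof
    show "inf_often (edge w ?q) \<subseteq> Y"
    proof
      fix x assume "x \<in> inf_often (edge w ?q)"
      from inf_often_later[OF this, of "h 0"] obtain k where "h 0 \<le> k" "edge w ?q k = x"
        by blast
      then show "x \<in> Y"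
        using later[of k] by simp
    qed
    show "Y \<subseteq> inf_often (edge w ?q)"
    proof (intro subsetI inf_oftenI)
      fix x n assume "x \<in> Y"
      then obtain k where "k \<in> {h n..<h (Suc n)}" "x = edge w ?q k"
        unfolding seg_Y[of n, symmetric] by blast
      moreover have "n \<le> h n"
        using h by (rule strict_mono_imp_increasing)
      ultimately show "\<exists>i\<ge>n. edge w ?q i = x"
        by (intro exI[of _ k]) auto
    qed
  qed
  moreover have "range (edge w ?q) = X \<union> Y"
  proof
    show "range (edge w ?q) \<subseteq> X \<union> Y"
    proof
      fix x assume "x \<in> range (edge w ?q)"
      then obtain k where x: "x = edge w ?q k"
        by blast
      show "x \<in> X \<union> Y"
      proof (cases "k < h 0")
        case True
        then have "edge w ?q k \<in> edge w ?q ` {0..<h 0}"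
          by (intro imageI) simp
        then show ?thesis
          unfolding x seg_X by blast
      qed (use later[of k] x in simp)
    qed
    show "X \<union> Y \<subseteq> range (edge w ?q)"
      unfolding seg_X[symmetric] seg_Y[of 0, symmetric] by blast
  qed
  moreover have "\<forall>k. ?q k < M" "?q 0 = p0"
    using r0 r(1) q0[of 0] by auto
  ultimately show "t \<in> runs M w"
    unfolding runs_def t by (intro CollectI exI[of _ ?q]) simp
qed

section \<open>The behavior as a supremum over lassos\<close>

definition edge_weight :: "wba \<Rightarrow> nat \<times> nat \<times> nat \<Rightarrow> ereal" where
  "edge_weight N = (\<lambda>(p, a, q). if p < nstates N \<and> q < nstates N then emb (wt N p a q) else -\<infinity>)"

text \<open>Excluding \<open>-\<infinity>\<close> loses only runs of weight
  \<open>-\<infinity>\<close> and also confines a run on \<open>M\<close> states to the states of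
  \<open>N\<close>. States visited infinitely often are the sources of recurring edges.\<close>

definition accepted ::
  "wba \<Rightarrow> nat \<times> (nat \<times> nat \<times> nat) set \<times> (nat \<times> nat \<times> nat) set \<Rightarrow> bool" where
  "accepted N = (\<lambda>(p, X, Y). p \<in> init N \<and> -\<infinity> \<notin> edge_weight N ` X \<and> fst ` Y \<inter> fin N \<noteq> {})"

definition run_value ::
  "valmonoid \<Rightarrow> wba \<Rightarrow> nat \<times> (nat \<times> nat \<times> nat) set \<times> (nat \<times> nat \<times> nat) set \<Rightarrow> ereal" where
  "run_value K N = (\<lambda>(p, X, Y). set_val K (edge_weight N ` X) (edge_weight N ` Y))"

lemma behavior_eq_runs:
  assumes w: "\<And>k. w k < m" and M: "nstates N \<le> M"
  shows "behavior K N w = (SUP t\<in>{t \<in> runs M w. accepted N t}. run_value K N t)"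
proof -
  let ?t = "\<lambda>q. (q 0, range (edge w q), inf_often (edge w q))"
  have weight: "path_weight K N w q = run_value K N (?t q)"
    if q: "\<And>k. q k < nstates N" and no: "-\<infinity> \<notin> edge_weight N ` range (edge w q)" for q
  proof -
    let ?d = "\<lambda>j. edge_weight N (edge w q j)"
    have fin: "finite (range (edge w q))"
      using w q by (rule finite_range_edge)
    have d: "?d = (\<lambda>j. emb (wt N (q j) (w j) (q (Suc j))))"
      using q by (auto simp: edge_weight_def edge_def)
    have r: "range ?d = edge_weight N ` range (edge w q)"
      by (simp add: image_image)
    then have "finite (range ?d)"
      using fin by simp
    then have "val K ?d = set_val K (range ?d) (inf_often ?d)"
      using no r by (intro val_eq_set_val) simp_all
    then show ?thesis
      unfolding path_weight_def d[symmetric] r run_value_def inf_often_image[OF fin] by simp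
  qed
  have acc: "successful N q \<and> -\<infinity> \<notin> edge_weight N ` range (edge w q) \<longleftrightarrow>
      accepted N (?t q)" if q: "\<And>k. q k < M" for q
  proof -
    have "finite (range (edge w q))"
      using w q by (rule finite_range_edge)
    then have "inf_often (\<lambda>k. fst (edge w q k)) = fst ` inf_often (edge w q)"
      by (rule inf_often_image)
    then have "fst ` inf_often (edge w q) = {f. \<exists>\<^sub>\<infinity>j. q j = f}"
      by (simp add: inf_often_def edge_def)
    moreover have "q j < nstates N" if "-\<infinity> \<notin> edge_weight N ` range (edge w q)" for j
    proof -
      have "edge_weight N (edge w q j) \<noteq> -\<infinity>"
        using that by (metis imageI rangeI)
      then show ?thesis
        by (auto simp: edge_weight_def edge_def split: if_splits)
    qed
    ultimately show ?thesis
      unfolding successful_def accepted_def by auto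
  qed
  show ?thesis
    unfolding behavior_def
  proof (rule antisym)
    show "Sup {path_weight K N w q |q. successful N q}
      \<le> (SUP t\<in>{t \<in> runs M w. accepted N t}. run_value K N t)"
    proof (rule Sup_least, clarify)
      fix q assume succ: "successful N q"
      then have q: "\<And>k. q k < nstates N"
        by (simp add: successful_def)
      then have qM: "\<And>k. q k < M"
        using M less_le_trans by blast
      show "path_weight K N w q \<le> (SUP t\<in>{t \<in> runs M w. accepted N t}. run_value K N t)"
      \<comment> \<open>A successful run through an edge of weight \<open>-\<infinity>\<close> is
        not accepted, but its weight lies below any supremum.\<close>
      proof (cases "-\<infinity> \<in> edge_weight N ` range (edge w q)")
        case True
        then have "\<exists>j. emb (wt N (q j) (w j) (q (Suc j))) = -\<infinity>"
          using q by (auto simp: edge_weight_def edge_def)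
        then have "path_weight K N w q = -\<infinity>"
          unfolding path_weight_def val_def by (rule if_P)
        then show ?thesis
          by simp
      next
        case False
        have "?t q \<in> runs M w"
          unfolding runs_def using qM by blast
        moreover have "accepted N (?t q)"
          using acc[of q] qM succ False by blast
        ultimately show ?thesis
          unfolding weight[OF q False] by (intro SUP_upper) simp
      qed
    qed
    show "(SUP t\<in>{t \<in> runs M w. accepted N t}. run_value K N t)
      \<le> Sup {path_weight K N w q |q. successful N q}"
    proof (rule SUP_least)
      fix t assume "t \<in> {t \<in> runs M w. accepted N t}"
      then obtain q where q: "\<And>k. q k < M" and t: "t = ?t q" and a: "accepted N t"
        by (auto simp: runs_def)
      have succ: "successful N q" and no: "-\<infinity> \<notin> edge_weight N ` range (edge w q)"
        using acc[of q] q a t by auto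
      then have "run_value K N t = path_weight K N w q"
        using weight[of q] t by (simp add: successful_def)
      then show "run_value K N t \<le> Sup {path_weight K N w q |q. successful N q}"
        using succ by (auto intro: Sup_upper)
    qed
  qed
qed

definition lasso_value :: "valmonoid \<Rightarrow> wba \<Rightarrow> profile \<Rightarrow> profile \<Rightarrow> ereal" where
  "lasso_value K N s e = (SUP t\<in>{t \<in> lassos s e. accepted N t}. run_value K N t)"

lemma behavior_eq_lasso_value:
  assumes "\<And>k. w k < m" "nstates N \<le> M" "ramsey_split M w h s e"
  shows "behavior K N w = lasso_value K N s e"
  unfolding lasso_value_def behavior_eq_runs[OF assms(1,2)]
  using runs_subset_lassos[OF assms(3,1)] lassos_subset_runs[OF assms(3)] by (simp add: subset_antisym)

text \<open>Both behaviors depend only on \<open>(s, e)\<close>. A pair found on a finite word is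
  realized by the periodic word built from it; conversely the pair of an infinite word is realized
  by a short word consisting of a stem and two copies of a cycle word.\<close>

theorem equivalence_iff_lassos:
  assumes M: "nstates N \<le> M" "nstates N' \<le> M"
  shows "(\<forall>w. (\<forall>i. w i < m) \<longrightarrow> behavior K N w = behavior K N' w) \<longleftrightarrow>
    (\<forall>k\<le>3 * card (prof_space m M). \<forall>j<k. \<forall>i<j. \<forall>w. (\<forall>l. w l < m) \<longrightarrow>
       prof M w 0 i = prof M w 0 j \<longrightarrow> prof M w i j = prof M w j k \<longrightarrow>
       prof M w i j = prof M w i k \<longrightarrow>
       lasso_value K N (prof M w 0 i) (prof M w i j) =
       lasso_value K N' (prof M w 0 i) (prof M w i j))" (is "?L \<longleftrightarrow> ?R")
proof
  assume L: ?L
  show ?R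
  proof (intro allI impI)
    fix k j i w
    assume ij: "j < k" "i < j" and w: "\<forall>l. w l < m"
      and p: "prof M w 0 i = prof M w 0 j" "prof M w i j = prof M w j k" "prof M w i j = prof M w i k"
    define v where "v = (\<lambda>l. if l < i then w l else w (i + (l - i) mod (j - i)))"
    have v: "\<And>l. v l < m"
      using w by (simp add: v_def)
    have "ramsey_split M v (\<lambda>l. i + l * (j - i)) (prof M w 0 i) (prof M w i j)"
      unfolding v_def by (rule ramsey_split_periodic[OF ij(2,1) p[symmetric]])
    from behavior_eq_lasso_value[OF v M(1) this] behavior_eq_lasso_value[OF v M(2) this]
    show "lasso_value K N (prof M w 0 i) (prof M w i j) =
       lasso_value K N' (prof M w 0 i) (prof M w i j)"
      using L v by metis
  qed
next
  assume R: ?R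
  show ?L
  proof (intro allI impI)
    fix w :: "nat \<Rightarrow> nat" assume w: "\<forall>i. w i < m"
    let ?B = "card (prof_space m M)"
    from w obtain h s e where split: "ramsey_split M w h s e"
      using ramsey_split_exists[of w m M] by blast
    then have s: "prof M w 0 (h i) = s" and e: "i < j \<Longrightarrow> prof M w (h i) (h j) = e"
      and h: "strict_mono h" for i j
      by (auto simp: ramsey_split_def)
    have h_mono: "h i \<le> h j" if "i \<le> j" for i j
      using that by (rule monoD[OF strict_mono_mono[OF h]])
    have idem: "prof_mult e e = e"
      using prof_split[OF h_mono[of 0 1] h_mono[of 1 2], of M w] e by simp
    have abs: "prof_mult s e = s"
      using prof_split[OF _ h_mono[of 0 1], of 0 M w] e[of 0 1] s by simp
    obtain u i where u: "\<forall>k. u k < m" "i \<le> ?B" "prof M u 0 i = s"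
      using short_representative[of w m M "h 0"] w s by metis
    \<comment> \<open>The block is nonempty, hence so is its short representative; the marks
      \<open>i < i + l < i + l + l\<close> rely on that.\<close>
    let ?p = "h 1 - h 0"
    have p: "0 < ?p" "h 0 + ?p = h 1"
      using strict_monoD[OF h, of 0 1] by simp_all
    have "prof M (\<lambda>k. w (h 0 + k)) 0 (0 + ?p) = prof M w (h 0) (h 0 + ?p)"
      by (rule prof_shift) simp
    then have "prof M (\<lambda>k. w (h 0 + k)) 0 ?p = e"
      using p(2) e[of 0 1] by simp
    then obtain v l where v: "\<forall>k. v k < m" "l \<le> ?B" "0 < l" "prof M v 0 l = e"
      using short_representative[of "\<lambda>k. w (h 0 + k)" m M ?p] w p(1) by metis
    \<comment> \<open>\<open>x\<close> is \<open>u v v\<close>: with the second copy of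
      \<open>v\<close>, \<open>e e = e\<close> becomes an equality of profiles of segments of
      \<open>x\<close>.\<close>
    define x where "x k = (if k < i then u k else if k < i + l then v (k - i) else v (k - i - l))" for k
    have x: "\<forall>k. x k < m"
      using u(1) v(1) by (simp add: x_def)
    have x_i: "prof M x 0 i = s"
      using prof_cong[of 0 i x u M] u(3) by (simp add: x_def)
    have "prof M x i (i + l) = prof M v 0 (0 + l)"
      by (rule prof_shift) (simp add: x_def)
    then have x_ij: "prof M x i (i + l) = e"
      using v(4) by simp
    have "prof M x (i + l) (i + l + l) = prof M v 0 (0 + l)"
      by (rule prof_shift) (simp add: x_def)
    then have x_jk: "prof M x (i + l) (i + l + l) = e"
      using v(4) by simp
    have x_j: "prof M x 0 (i + l) = s"
      using prof_split[of 0 i "i + l" M x] x_i x_ij abs by simp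
    have x_ik: "prof M x i (i + l + l) = e"
      using prof_split[of i "i + l" "i + l + l" M x] x_ij x_jk idem by simp
    have "i + l + l \<le> 3 * ?B" "i + l < i + l + l" "i < i + l"
      using u(2) v(2,3) by auto
    with R x have "lasso_value K N (prof M x 0 i) (prof M x i (i + l)) =
        lasso_value K N' (prof M x 0 i) (prof M x i (i + l))"
      using x_i x_ij x_jk x_j x_ik by metis
    then show "behavior K N w = behavior K N' w"
      using behavior_eq_lasso_value[OF w[rule_format] M(1) split]
        behavior_eq_lasso_value[OF w[rule_format] M(2) split]
        x_i x_ij by simp
  qed
qed

section \<open>The decision formula\<close>

definition dig :: "nat \<Rightarrow> nat \<Rightarrow> nat \<Rightarrow> nat" where
  "dig b x k = x div b ^ k mod b"

text \<open>\<open>list_encode\<close> codes a nonempty list as the successor of the pair of head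
  and coded tail, hence \<open>c - 1\<close>.\<close>

definition hd_code :: "nat \<Rightarrow> nat" where "hd_code c = pfst (c - 1)"
definition tl_code :: "nat \<Rightarrow> nat" where "tl_code c = psnd (c - 1)"

definition nth_code :: "nat \<Rightarrow> nat \<Rightarrow> nat" where
  "nth_code c k = hd_code (rec_nat c (\<lambda>_. tl_code) k)"

text \<open>The weights form a flat list ordered by \<open>p\<close>, then \<open>a\<close>, then
  \<open>q\<close>; this is the row-major index into it.\<close>

definition wt_code :: "nat \<Rightarrow> nat \<Rightarrow> nat \<Rightarrow> nat \<Rightarrow> nat \<Rightarrow> nat" where
  "wt_code m c p a q = nth_code (nth_code c 1) ((p * m + a) * nth_code c 0 + q)"

text \<open>\<open>int_encode\<close> sends \<open>n \<ge> 0\<close> to \<open>2 * n\<close> and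
  \<open>- n - 1\<close> to \<open>2 * n + 1\<close>. Positive and negative parts keep the
  comparison of fractions within the natural numbers.\<close>

definition pos_code :: "nat \<Rightarrow> nat" where "pos_code c = (if c mod 2 = 0 then c div 2 else 0)"
definition neg_code :: "nat \<Rightarrow> nat" where "neg_code c = (if c mod 2 = 0 then 0 else Suc (c div 2))"

text \<open>Cross-multiplied comparison of fractions, with the negative parts moved to the other side.\<close>

definition rat_le_code :: "nat \<Rightarrow> nat \<Rightarrow> bool" where
  "rat_le_code c d \<longleftrightarrow>
     pos_code (pfst c) * (psnd d div 2) + neg_code (pfst d) * (psnd c div 2)
     \<le> pos_code (pfst d) * (psnd c div 2) + neg_code (pfst c) * (psnd d div 2)"

text \<open>Correct for codes other than that of \<open>NegInf\<close>.\<close>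

definition le_code :: "nat \<Rightarrow> nat \<Rightarrow> bool" where
  "le_code c d \<longleftrightarrow> d = 1 \<or> c \<noteq> 1 \<and> rat_le_code (c - 2) (d - 2)"

text \<open>Here and below, the base \<open>m\<close> digits of \<open>x\<close> are the letters of
  a word and the base \<open>M\<close> digits of \<open>y\<close> the states of a run on it.\<close>

definition step_code :: "nat \<Rightarrow> nat \<Rightarrow> nat \<Rightarrow> nat \<Rightarrow> nat \<Rightarrow> nat \<Rightarrow> nat" where
  "step_code m M c x y l = wt_code m c (dig M y l) (dig m x l) (dig M y (Suc l))"

text \<open>Components 0, 2 and 3 of \<open>c\<close> hold the number of states and the
  characteristic lists of initial and final states; weight code 0 stands for \<open>NegInf\<close>.
  Apart from the closing condition at \<open>i\<close> and \<open>j\<close> this is the coded form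
  of \<open>accepted\<close>.\<close>

definition lasso_code :: "nat \<Rightarrow> nat \<Rightarrow> nat \<Rightarrow> nat \<Rightarrow> nat \<Rightarrow> nat \<Rightarrow> nat \<Rightarrow> bool" where
  "lasso_code m M c x y i j \<longleftrightarrow>
     nth_code (nth_code c 2) (dig M y 0) = 1 \<and> dig M y i = dig M y j \<and>
     (\<forall>l<j. dig M y l < nth_code c 0 \<and> dig M y (Suc l) < nth_code c 0 \<and> step_code m M c x y l \<noteq> 0) \<and>
     (\<exists>l<j. i \<le> l \<and> nth_code (nth_code c 3) (dig M y l) = 1)"

text \<open>The weight of a lasso is located rather than computed: it is attained at an edge, and
  \<open>k\<close> is the position of such an edge. Code 1 stands for \<open>PosInf\<close>; if all
  weights are infinite, any position serves.\<close>

definition opt_code :: "valmonoid \<Rightarrow> (nat \<Rightarrow> nat) \<Rightarrow> nat \<Rightarrow> nat \<Rightarrow> nat \<Rightarrow> bool" where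
  "opt_code K d i j k \<longleftrightarrow> (\<forall>l<j. d l = 1) \<or> d k \<noteq> 1 \<and>
     (case K of
        K1 \<Rightarrow> if \<exists>l<j. i \<le> l \<and> d l \<noteq> 1
              then i \<le> k \<and> (\<forall>l<j. i \<le> l \<longrightarrow> d l \<noteq> 1 \<longrightarrow> le_code (d k) (d l))
              else \<forall>l<j. d l \<noteq> 1 \<longrightarrow> le_code (d k) (d l)
      | K2 \<Rightarrow> if \<exists>l<j. i \<le> l \<and> d l \<noteq> 1
              then i \<le> k \<and> (\<forall>l<j. i \<le> l \<longrightarrow> d l \<noteq> 1 \<longrightarrow> le_code (d l) (d k))
              else \<forall>l<j. d l \<noteq> 1 \<longrightarrow> le_code (d l) (d k)
      | K3 \<Rightarrow> \<forall>l<j. d l \<noteq> 1 \<longrightarrow> le_code (d l) (d k))"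

text \<open>An inequality between two suprema, expressed without computing either. The bound
  \<open>M ^ Suc j\<close> leaves room for the \<open>j + 1\<close> states at positions 0 to
  \<open>j\<close>.\<close>

definition dominated_code ::
  "valmonoid \<Rightarrow> nat \<Rightarrow> nat \<Rightarrow> nat \<Rightarrow> nat \<Rightarrow> nat \<Rightarrow> nat \<Rightarrow> nat \<Rightarrow> bool" where
  "dominated_code K m M c c' x i j \<longleftrightarrow>
     (\<forall>y<M ^ Suc j. lasso_code m M c x y i j \<longrightarrow>
        (\<exists>y'<M ^ Suc j. lasso_code m M c' x y' i j \<and>
           (\<exists>k<j. \<exists>k'<j. opt_code K (step_code m M c x y) i j k \<and>
              opt_code K (step_code m M c' x y') i j k' \<and>
              le_code (step_code m M c x y k) (step_code m M c' x y' k'))))"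

definition step_in_code ::
  "nat \<Rightarrow> nat \<Rightarrow> nat \<Rightarrow> nat \<Rightarrow> nat \<Rightarrow> nat \<Rightarrow> nat \<Rightarrow> nat \<Rightarrow> bool" where
  "step_in_code m M x y k y' c d \<longleftrightarrow>
     (\<exists>k'<d. c \<le> k' \<and> dig M y k = dig M y' k' \<and> dig m x k = dig m x k' \<and>
        dig M y (Suc k) = dig M y' (Suc k'))"

text \<open>Inclusion of profiles: each run over the first segment has a counterpart over the second
  with the same ends and the same set of edges, the latter by mutual inclusion. Runs are coded from
  position 0 so that digits sit at absolute positions.\<close>

definition prof_sub_code :: "nat \<Rightarrow> nat \<Rightarrow> nat \<Rightarrow> nat \<Rightarrow> nat \<Rightarrow> nat \<Rightarrow> nat \<Rightarrow> bool" where
  "prof_sub_code m M x a b c d \<longleftrightarrow>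
     (\<forall>y<M ^ Suc b. \<exists>y'<M ^ Suc d. dig M y a = dig M y' c \<and> dig M y b = dig M y' d \<and>
        (\<forall>k<b. a \<le> k \<longrightarrow> step_in_code m M x y k y' c d) \<and>
        (\<forall>k<d. c \<le> k \<longrightarrow> step_in_code m M x y' k y a b))"

definition prof_eq_code :: "nat \<Rightarrow> nat \<Rightarrow> nat \<Rightarrow> nat \<Rightarrow> nat \<Rightarrow> nat \<Rightarrow> nat \<Rightarrow> bool" where
  "prof_eq_code m M x a b c d \<longleftrightarrow> prof_sub_code m M x a b c d \<and> prof_sub_code m M x c d a b"

text \<open>The number of possible profiles: a profile is a set of triples, drawn from
  \<open>M * M * 2 ^ (M * m * M)\<close> many.\<close>

definition prof_bound :: "nat \<Rightarrow> nat \<Rightarrow> nat" where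
  "prof_bound m M = 2 ^ (M * M * 2 ^ (M * m * M))"

definition decision :: "valmonoid \<Rightarrow> nat \<Rightarrow> nat \<Rightarrow> nat \<Rightarrow> nat \<Rightarrow> bool" where
  "decision K m M c c' \<longleftrightarrow>
     (\<forall>k<Suc (3 * prof_bound m M). \<forall>j<k. \<forall>i<j. \<forall>x<m ^ k.
        prof_eq_code m M x 0 i 0 j \<and> prof_eq_code m M x i j j k \<and> prof_eq_code m M x i j i k \<longrightarrow>
        dominated_code K m M c c' x i j \<and> dominated_code K m M c' c x i j)"

section \<open>Decidability of the formula\<close>

lemma computable_dig:
  "computable b \<Longrightarrow> computable x \<Longrightarrow> computable k \<Longrightarrow> computable (\<lambda>z. dig (b z) (x z) (k z))"
  unfolding dig_def by (intro computable_intros)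

lemma computable_nth_code:
  assumes "computable c" "computable k"
  shows "computable (\<lambda>z. nth_code (c z) (k z))"
  unfolding nth_code_def hd_code_def tl_code_def
  by (intro computable_intros computable_rec_nat assms)

lemma computable_wt_code:
  assumes "computable c" "computable p" "computable a" "computable q"
  shows "computable (\<lambda>z. wt_code m (c z) (p z) (a z) (q z))"
  unfolding wt_code_def by (intro computable_intros computable_nth_code assms)

lemma decidable_le_code:
  assumes "computable c" "computable d"
  shows "decidable (\<lambda>z. le_code (c z) (d z))"
  unfolding le_code_def rat_le_code_def pos_code_def neg_code_def
  by (intro computable_intros assms)

lemma computable_step_code:
  assumes "computable M" "computable c" "computable x" "computable y" "computable l"
  shows "computable (\<lambda>z. step_code m (M z) (c z) (x z) (y z) (l z))"
  unfolding step_code_def by (intro computable_intros computable_wt_code computable_dig assms)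

text \<open>A bounded quantifier turns the context into a pair, so each parameter is needed also
  after composition with projections; \<open>assms[THEN computable_comp]\<close> supplies this here
  and below.\<close>

lemma decidable_lasso_code:
  assumes "computable M" "computable c" "computable x" "computable y" "computable i" "computable j"
  shows "decidable (\<lambda>z. lasso_code m (M z) (c z) (x z) (y z) (i z) (j z))"
  unfolding lasso_code_def
  by (intro computable_intros computable_nth_code computable_step_code computable_dig
      assms assms[THEN computable_comp])

lemma decidable_opt_code:
  assumes d: "computable (\<lambda>z. d (pfst z) (psnd z))"
    and "computable i" "computable j" "computable k"
  shows "decidable (\<lambda>z. opt_code K (d z) (i z) (j z) (k z))"
proof -
  have d': "computable (\<lambda>z. d (f z) (g z))" if "computable f" "computable g" for f g
    using computable_comp[OF d computable2_comp[OF computable2_pair that]] by simp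
  show ?thesis
    unfolding opt_code_def
    by (cases K; simp only: valmonoid.case)
      (intro computable_intros d' decidable_le_code assms(2-) assms(2-)[THEN computable_comp])+
qed

lemma decidable_dominated_code:
  assumes "computable M" "computable c" "computable c'" "computable x" "computable i" "computable j"
  shows "decidable (\<lambda>z. dominated_code K m (M z) (c z) (c' z) (x z) (i z) (j z))"
  unfolding dominated_code_def
  by (intro computable_intros decidable_lasso_code decidable_opt_code decidable_le_code
      computable_step_code assms assms[THEN computable_comp])

lemma decidable_prof_eq_code:
  assumes "computable M" "computable x" "computable a" "computable b" "computable c" "computable d"
  shows "decidable (\<lambda>z. prof_eq_code m (M z) (x z) (a z) (b z) (c z) (d z))"
  unfolding prof_eq_code_def prof_sub_code_def step_in_code_def
  by (intro computable_intros computable_dig assms assms[THEN computable_comp])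

lemma decidable_decision:
  assumes "computable M" "computable c" "computable c'"
  shows "decidable (\<lambda>z. decision K m (M z) (c z) (c' z))"
  unfolding decision_def prof_bound_def
  by (intro computable_intros decidable_prof_eq_code decidable_dominated_code
      assms assms[THEN computable_comp])

section \<open>Correctness of the decision formula\<close>

lemma dig_less: "0 < b \<Longrightarrow> dig b x k < b"
  by (simp add: dig_def)

text \<open>Horner's scheme: \<open>f 0\<close> is the lowest digit and the shifted sequence yields
  the others. It turns quantifiers over words and runs into bounded quantifiers over
  numbers.\<close>

lemma digits_exist:
  assumes "\<And>k. k < l \<Longrightarrow> f k < b"
  shows "\<exists>x<b ^ l. \<forall>k<l. dig b x k = f k"
  using assms
proof (induction l arbitrary: f)
  case (Suc l)
  obtain x where x: "x < b ^ l" "\<And>k. k < l \<Longrightarrow> dig b x k = f (Suc k)"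
    using Suc.IH[of "\<lambda>k. f (Suc k)"] Suc.prems by auto
  have f0: "f 0 < b"
    using Suc.prems by simp
  let ?x = "f 0 + b * x"
  have "?x < b * Suc x"
    using f0 by simp
  also have "\<dots> \<le> b * b ^ l"
    using x(1) by (intro mult_le_mono2) simp
  finally have "?x < b ^ Suc l"
    by simp
  moreover have "dig b ?x k = f k" if "k < Suc l" for k
  proof (cases k)
    case 0
    then show ?thesis
      using f0 by (simp add: dig_def)
  next
    case (Suc k')
    have "?x div b ^ Suc k' = x div b ^ k'"
      using f0 by (simp add: div_mult2_eq)
    then show ?thesis
      using x(2)[of k'] that Suc by (simp add: dig_def)
  qed
  ultimately show ?case
    by blast
qed simp

lemma prof_code_iff:
  assumes "a \<le> b"
  shows "(p, r, X) \<in> prof M w a b \<longleftrightarrow>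
    (\<exists>y<M ^ Suc b. p = dig M y a \<and> r = dig M y b \<and> X = edge w (dig M y) ` {a..<b})"
proof
  assume "(p, r, X) \<in> prof M w a b"
  then obtain q where q: "\<And>k. q k < M" "p = q a" "r = q b" "X = edge w q ` {a..<b}"
    unfolding prof_iff by blast
  obtain y where y: "y < M ^ Suc b" "\<And>k. k < Suc b \<Longrightarrow> dig M y k = q k"
    using digits_exist[of "Suc b" q M] q(1) by blast
  have "edge w q ` {a..<b} = edge w (dig M y) ` {a..<b}"
    by (intro image_cong refl) (auto simp: edge_def y(2))
  then show "\<exists>y<M ^ Suc b. p = dig M y a \<and> r = dig M y b \<and> X = edge w (dig M y) ` {a..<b}"
    using q y assms by (intro exI[of _ y]) simp
next
  assume "\<exists>y<M ^ Suc b. p = dig M y a \<and> r = dig M y b \<and> X = edge w (dig M y) ` {a..<b}"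
  then obtain y where y: "y < M ^ Suc b" "p = dig M y a" "r = dig M y b"
    "X = edge w (dig M y) ` {a..<b}"
    by blast
  \<comment> \<open>A base is positive as soon as some number lies below a positive power of it;
    \<open>dig_less\<close> needs this.\<close>
  from y(1) have "0 < M"
    by (cases M) auto
  then show "(p, r, X) \<in> prof M w a b"
    unfolding prof_iff using y dig_less by blast
qed

lemma prof_sub_code_iff:
  assumes "a \<le> b" "c \<le> d"
  shows "prof_sub_code m M x a b c d \<longleftrightarrow> prof M (dig m x) a b \<subseteq> prof M (dig m x) c d"
proof -
  let ?E = "\<lambda>y. edge (dig m x) (dig M y)"
  have step: "step_in_code m M x y k y' c d \<longleftrightarrow> ?E y k \<in> ?E y' ` {c..<d}" for y y' k c d
    by (auto simp: step_in_code_def edge_def image_iff Bex_def)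
  have eq: "(\<forall>k<b. a \<le> k \<longrightarrow> step_in_code m M x y k y' c d) \<and>
        (\<forall>k<d. c \<le> k \<longrightarrow> step_in_code m M x y' k y a b) \<longleftrightarrow>
        ?E y ` {a..<b} = ?E y' ` {c..<d}" for y y'
    unfolding step by auto
  have "prof_sub_code m M x a b c d \<longleftrightarrow> (\<forall>y<M ^ Suc b.
      (dig M y a, dig M y b, ?E y ` {a..<b}) \<in> prof M (dig m x) c d)"
    unfolding prof_sub_code_def eq prof_code_iff[OF assms(2)] ..
  also have "\<dots> \<longleftrightarrow> prof M (dig m x) a b \<subseteq> prof M (dig m x) c d"
  proof
    assume L: "\<forall>y<M ^ Suc b. (dig M y a, dig M y b, ?E y ` {a..<b}) \<in> prof M (dig m x) c d"
    show "prof M (dig m x) a b \<subseteq> prof M (dig m x) c d"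
    proof
      fix t assume t: "t \<in> prof M (dig m x) a b"
      obtain p r X where t_eq: "t = (p, r, X)"
        by (cases t)
      obtain y where "y < M ^ Suc b" "t = (dig M y a, dig M y b, ?E y ` {a..<b})"
        using t unfolding t_eq prof_code_iff[OF assms(1)] by blast
      then show "t \<in> prof M (dig m x) c d"
        using L by blast
    qed
  qed (use prof_code_iff[OF assms(1)] in blast)
  finally show ?thesis .
qed

lemma prof_eq_code_iff:
  assumes "a \<le> b" "c \<le> d"
  shows "prof_eq_code m M x a b c d \<longleftrightarrow> prof M (dig m x) a b = prof M (dig m x) c d"
  unfolding prof_eq_code_def prof_sub_code_iff[OF assms] prof_sub_code_iff[OF assms(2,1)]
    set_eq_subset ..

text \<open>Stem and cycle meet at position \<open>i\<close>, so they glue to one run over the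
  positions 0 to \<open>j\<close>, which a single number codes.\<close>

lemma lassos_code:
  assumes ij: "i < j"
  shows "lassos (prof M w 0 i) (prof M w i j) =
    (\<lambda>y. (dig M y 0, edge w (dig M y) ` {..<j}, edge w (dig M y) ` {i..<j})) `
      {y. y < M ^ Suc j \<and> dig M y i = dig M y j}" (is "?L = ?f ` ?Y")
proof (intro set_eqI iffI)
  have ivl: "{..<j} = {0..<i} \<union> {i..<j}"
    using ij by auto
  fix t
  {
    assume "t \<in> ?L"
    then obtain p p' X X' where t: "t = (p, X \<union> X', X')"
      and X: "(p, p', X) \<in> prof M w 0 i" and X': "(p', p', X') \<in> prof M w i j"
      unfolding lassos_def by blast
    obtain q where q: "\<And>k. q k < M" "p = q 0" "p' = q i" "X = edge w q ` {0..<i}"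
      using X unfolding prof_iff by blast
    obtain q' where q': "\<And>k. q' k < M" "p' = q' i" "p' = q' j" "X' = edge w q' ` {i..<j}"
      using X' unfolding prof_iff by blast
    obtain r where r: "\<And>l. r l < M" "r 0 = q 0" "r i = q i" "r j = q' j"
      "edge w r ` {0..<i} = edge w q ` {0..<i}" "edge w r ` {i..<j} = edge w q' ` {i..<j}"
      using prof_glue[of 0 i j q M q' w] ij q q' by auto
    obtain y where y: "y < M ^ Suc j" "\<And>k. k < Suc j \<Longrightarrow> dig M y k = r k"
      using digits_exist[of "Suc j" r M] r(1) by blast
    have E: "edge w (dig M y) l = edge w r l" if "l < j" for l
      using that by (simp add: edge_def y(2))
    have "edge w (dig M y) ` {0..<i} = edge w r ` {0..<i}"
      "edge w (dig M y) ` {i..<j} = edge w r ` {i..<j}"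
      using ij by (auto intro!: image_cong E)
    then have "t = ?f y"
      unfolding t ivl image_Un using r y(2) q q' by simp
    moreover have "y \<in> ?Y"
      using y r q q' ij by simp
    ultimately show "t \<in> ?f ` ?Y"
      by blast
  next
    assume "t \<in> ?f ` ?Y"
    then obtain y where y: "y < M ^ Suc j" "dig M y i = dig M y j" and t: "t = ?f y"
      by blast
    from y(1) have "0 < M"
      by (cases M) auto
    then have "(dig M y 0, dig M y i, edge w (dig M y) ` {0..<i}) \<in> prof M w 0 i"
      "(dig M y i, dig M y i, edge w (dig M y) ` {i..<j}) \<in> prof M w i j"
      unfolding prof_iff using y(2) dig_less by blast+
    then show "t \<in> ?L"
      unfolding lassos_def t ivl image_Un by blast
  }
qed

section \<open>Decoding automata and weights\<close>

lemma nth_code_list_encode: "k < length xs \<Longrightarrow> nth_code (list_encode xs) k = xs ! k"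
proof (induction xs arbitrary: k)
  case (Cons y ys)
  \<comment> \<open>\<open>rec_nat\<close> peels off the last application of the tail function, the
    induction on the list needs the first.\<close>
  have shift: "rec_nat z (\<lambda>_. tl_code) (Suc k) = rec_nat (tl_code z) (\<lambda>_. tl_code) k" for z k
    by (induction k) auto
  show ?case
    using Cons by (cases k) (simp_all add: nth_code_def shift hd_code_def tl_code_def del: nat.rec(2))
qed simp

lemma nth_concat_uniform:
  "\<lbrakk>\<And>xs. xs \<in> set xss \<Longrightarrow> length xs = l; i < length xss; j < l\<rbrakk> \<Longrightarrow>
    concat xss ! (i * l + j) = xss ! i ! j"
proof (induction xss arbitrary: i)
  case (Cons xs xss)
  then show ?case
    by (cases i) (simp_all add: nth_append)
qed simp

lemma length_concat_uniform:
  "(\<And>xs. xs \<in> set xss \<Longrightarrow> length xs = l) \<Longrightarrow> length (concat xss) = length xss * l"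
  by (induction xss) auto

lemma index_less:
  fixes p a :: nat
  assumes "p < n" "a < l"
  shows "p * l + a < n * l"
proof -
  have "p * l + a < Suc p * l"
    using assms(2) by simp
  also have "\<dots> \<le> n * l"
    using assms(1) by (intro mult_le_mono1) simp
  finally show ?thesis .
qed

lemma enc_wba_decode:
  fixes N m
  defines "c \<equiv> enc_wba m N" and "n \<equiv> nstates N"
  shows "nth_code c 0 = n"
    and "p < n \<Longrightarrow> nth_code (nth_code c 2) p = 1 \<longleftrightarrow> p \<in> init N"
    and "p < n \<Longrightarrow> nth_code (nth_code c 3) p = 1 \<longleftrightarrow> p \<in> fin N"
    and "p < n \<Longrightarrow> a < m \<Longrightarrow> q < n \<Longrightarrow> wt_code m c p a q = enc_qbar (wt N p a q)"
proof -
  let ?row = "\<lambda>p a. map (\<lambda>q. enc_qbar (wt N p a q)) [0..<n]"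
  let ?mat = "\<lambda>p. concat (map (?row p) [0..<m])"
  let ?ws = "concat (map ?mat [0..<n])"
  let ?b = "\<lambda>A. map (\<lambda>p. if p \<in> A then 1 else 0) [0..<n]"
  have c: "c = list_encode [n, list_encode ?ws, list_encode (?b (init N)), list_encode (?b (fin N))]"
    by (simp add: c_def n_def enc_wba_def Let_def)
  show n: "nth_code c 0 = n"
    by (simp add: c nth_code_list_encode del: list_encode.simps)
  have comps: "nth_code c 1 = list_encode ?ws" "nth_code c 2 = list_encode (?b (init N))"
    "nth_code c 3 = list_encode (?b (fin N))"
    by (simp_all add: c nth_code_list_encode del: list_encode.simps)
  show "p < n \<Longrightarrow> nth_code (nth_code c 2) p = 1 \<longleftrightarrow> p \<in> init N"
    "p < n \<Longrightarrow> nth_code (nth_code c 3) p = 1 \<longleftrightarrow> p \<in> fin N"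
    by (simp_all add: comps nth_code_list_encode del: list_encode.simps)
  assume less: "p < n" "a < m" "q < n"
  have row: "length (?row p a) = n" for p a
    by simp
  have mat: "length (?mat p) = m * n" for p
    by (subst length_concat_uniform[where l = n]) auto
  have len: "length ?ws = n * (m * n)"
    by (subst length_concat_uniform[where l = "m * n"]) (auto simp: mat simp del: length_concat)
  \<comment> \<open>Regrouped to follow the nested concatenation: a block of length
    \<open>m * n\<close> for each \<open>p\<close>, and in it a row of length \<open>n\<close> for
    each \<open>a\<close>.\<close>
  have idx: "(p * m + a) * n + q = p * (m * n) + (a * n + q)"
    by (simp add: algebra_simps)
  have lt: "a * n + q < m * n"
    using less by (intro index_less)
  have "nth_code (nth_code c 1) ((p * m + a) * n + q) = ?ws ! (p * (m * n) + (a * n + q))"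
    unfolding comps idx using less(1) lt by (intro nth_code_list_encode) (simp only: len index_less)
  also have "\<dots> = ?mat p ! (a * n + q)"
    using less(1) lt by (subst nth_concat_uniform) (auto simp: mat simp del: length_concat)
  also have "\<dots> = enc_qbar (wt N p a q)"
    using less by (subst nth_concat_uniform) auto
  finally show "wt_code m c p a q = enc_qbar (wt N p a q)"
    by (simp add: wt_code_def n)
qed

lemma pos_neg_code: "int (pos_code (int_encode p)) - int (neg_code (int_encode p)) = p"
  by (auto simp: pos_code_def neg_code_def int_encode_def sum_encode_def)

lemma int_encode_div2: "0 \<le> p \<Longrightarrow> int (int_encode p div 2) = p"
  by (simp add: int_encode_def sum_encode_def)

lemma rat_le_code_iff: "rat_le_code (enc_rat r) (enc_rat r') \<longleftrightarrow> r \<le> r'"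
proof -
  obtain p q where r: "quotient_of r = (p, q)"
    by (cases "quotient_of r")
  obtain p' q' where r': "quotient_of r' = (p', q')"
    by (cases "quotient_of r'")
  \<comment> \<open>Positive denominators have even codes, so \<open>div 2\<close> decodes them, and
    they allow cross-multiplication.\<close>
  have q: "0 < q" "0 < q'"
    using quotient_of_denom_pos[OF r] quotient_of_denom_pos[OF r'] by auto
  let ?p = "int (pos_code (int_encode p))" and ?n = "int (neg_code (int_encode p))"
  let ?p' = "int (pos_code (int_encode p'))" and ?n' = "int (neg_code (int_encode p'))"
  have "rat_le_code (enc_rat r) (enc_rat r') \<longleftrightarrow> ?p * q' + ?n' * q \<le> ?p' * q + ?n * q'"
    unfolding rat_le_code_def enc_rat_def r r'
    by (simp only: prod.case pfst_encode psnd_encode of_nat_le_iff[symmetric, where 'a = int]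
        of_nat_add of_nat_mult int_encode_div2[OF less_imp_le[OF q(1)]]
        int_encode_div2[OF less_imp_le[OF q(2)]])
  also have "\<dots> \<longleftrightarrow> (?p - ?n) * q' \<le> (?p' - ?n') * q"
    by (simp add: algebra_simps)
  also have "\<dots> \<longleftrightarrow> p * q' \<le> p' * q"
    unfolding pos_neg_code ..
  also have "\<dots> \<longleftrightarrow> (of_int (p * q') :: rat) \<le> of_int (p' * q)"
    by (rule of_int_le_iff[symmetric])
  also have "\<dots> \<longleftrightarrow> r \<le> r'"
    unfolding quotient_of_div[OF r] quotient_of_div[OF r'] using q by (simp add: field_simps)
  finally show ?thesis .
qed

lemma le_code_iff:
  assumes "u \<noteq> NegInf" "v \<noteq> NegInf"
  shows "le_code (enc_qbar u) (enc_qbar v) \<longleftrightarrow> emb u \<le> emb v"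
  using assms by (cases u; cases v) (auto simp: le_code_def rat_le_code_iff of_rat_less_eq)

lemma enc_qbar_eq_0: "enc_qbar u = 0 \<longleftrightarrow> u = NegInf"
  by (cases u) auto

lemma enc_qbar_eq_1: "enc_qbar u = 1 \<longleftrightarrow> emb u = \<infinity>"
  by (cases u) auto

lemma emb_eq_MInf: "emb u = -\<infinity> \<longleftrightarrow> u = NegInf"
  by (cases u) auto

text \<open>Both branches of the case distinctions of \<open>set_val\<close> and \<open>opt_code\<close> optimise over the
  finite weights at the following positions.\<close>

definition opt_range :: "valmonoid \<Rightarrow> (nat \<Rightarrow> ereal) \<Rightarrow> nat \<Rightarrow> nat \<Rightarrow> nat set" where
  "opt_range K g i j =
     {l. (if K \<noteq> K3 \<and> (\<exists>l<j. i \<le> l \<and> g l \<noteq> \<infinity>) then i \<le> l else True) \<and> l < j \<and> g l \<noteq> \<infinity>}"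

lemma set_val_opt_range:
  assumes "i < j" "\<not> (\<forall>l<j. g l = \<infinity>)"
  shows "set_val K (g ` {..<j}) (g ` {i..<j}) =
    (if K = K1 then Inf (g ` opt_range K g i j) else Sup (g ` opt_range K g i j))"
proof -
  have Y: "g ` {i..<j} \<subseteq> {\<infinity>} \<longleftrightarrow> \<not> (\<exists>l<j. i \<le> l \<and> g l \<noteq> \<infinity>)"
    by (auto simp: image_subset_iff)
  have X: "\<not> g ` {..<j} \<subseteq> {\<infinity>}"
    using assms by auto
  have R: "g ` opt_range K g i j =
      (if K = K3 \<or> g ` {i..<j} \<subseteq> {\<infinity>} then g ` {..<j} else g ` {i..<j}) - {\<infinity>}"
  proof -
    define b where "b = (\<exists>l<j. i \<le> l \<and> g l \<noteq> \<infinity>)"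
    have "g ` {l. l < j \<and> g l \<noteq> \<infinity>} = g ` {..<j} - {\<infinity>}"
      "g ` {l. i \<le> l \<and> l < j \<and> g l \<noteq> \<infinity>} = g ` {i..<j} - {\<infinity>}"
      by auto
    then show ?thesis
      unfolding Y opt_range_def b_def[symmetric] by (cases "K = K3"; cases b) simp_all
  qed
  show ?thesis
    unfolding R set_val_def using X by (simp split: valmonoid.split)
qed

text \<open>Three views of the weights along a lasso: \<open>v\<close> in \<open>qbar\<close>,
  \<open>d\<close> as codes and \<open>g\<close> in \<open>ereal\<close>.\<close>

context
  fixes v :: "nat \<Rightarrow> qbar" and d :: "nat \<Rightarrow> nat" and g :: "nat \<Rightarrow> ereal" and i j :: nat
  assumes ij: "i < j"
    and d: "\<And>l. l < j \<Longrightarrow> d l = enc_qbar (v l)"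
    and v: "\<And>l. l < j \<Longrightarrow> v l \<noteq> NegInf"
    and g: "\<And>l. l < j \<Longrightarrow> g l = emb (v l)"
begin

lemma opt_code_iff:
  assumes "k < j"
  shows "opt_code K d i j k \<longleftrightarrow> (\<forall>l<j. g l = \<infinity>) \<or>
    k \<in> opt_range K g i j \<and>
    (\<forall>l\<in>opt_range K g i j. if K = K1 then g k \<le> g l else g l \<le> g k)"
proof -
  have one: "d l = 1 \<longleftrightarrow> g l = \<infinity>" if "l < j" for l
    using that by (simp add: d g enc_qbar_eq_1[simplified])
  have le: "le_code (d l) (d l') \<longleftrightarrow> g l \<le> g l'" if "l < j" "l' < j" for l l'
    using that by (simp add: d g le_code_iff v)
  define b where "b = (\<exists>l<j. i \<le> l \<and> g l \<noteq> \<infinity>)"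
  have all: "(\<forall>l<j. d l = 1) \<longleftrightarrow> (\<forall>l<j. g l = \<infinity>)"
    and ex: "(\<exists>l<j. i \<le> l \<and> d l \<noteq> 1) \<longleftrightarrow> b"
    unfolding b_def using one by blast+
  have cmp: "(\<forall>l<j. d l \<noteq> 1 \<longrightarrow> le_code (d k) (d l)) \<longleftrightarrow> (\<forall>l<j. g l \<noteq> \<infinity> \<longrightarrow> g k \<le> g l)"
    "(\<forall>l<j. i \<le> l \<longrightarrow> d l \<noteq> 1 \<longrightarrow> le_code (d k) (d l)) \<longleftrightarrow>
      (\<forall>l<j. i \<le> l \<longrightarrow> g l \<noteq> \<infinity> \<longrightarrow> g k \<le> g l)"
    "(\<forall>l<j. d l \<noteq> 1 \<longrightarrow> le_code (d l) (d k)) \<longleftrightarrow> (\<forall>l<j. g l \<noteq> \<infinity> \<longrightarrow> g l \<le> g k)"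
    "(\<forall>l<j. i \<le> l \<longrightarrow> d l \<noteq> 1 \<longrightarrow> le_code (d l) (d k)) \<longleftrightarrow>
      (\<forall>l<j. i \<le> l \<longrightarrow> g l \<noteq> \<infinity> \<longrightarrow> g l \<le> g k)"
    using one le[OF assms] le[OF _ assms] by blast+
  show ?thesis
    unfolding opt_code_def opt_range_def all ex cmp one[OF assms] b_def[symmetric] mem_Collect_eq
      Ball_def
    using assms by (cases K; cases b; simp only: valmonoid.case valmonoid.distinct simp_thms if_True if_False; blast)
qed

lemma opt_code_set_val:
  assumes "k < j" "opt_code K d i j k"
  shows "g k = set_val K (g ` {..<j}) (g ` {i..<j})"
proof (cases "\<forall>l<j. g l = \<infinity>")
  case True
  then show ?thesis
    using assms(1) by (auto simp: set_val_def)
next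
  case False
  then have k: "k \<in> opt_range K g i j"
    and opt: "\<And>l. l \<in> opt_range K g i j \<Longrightarrow> if K = K1 then g k \<le> g l else g l \<le> g k"
    using assms by (auto simp: opt_code_iff)
  show ?thesis
  proof (cases "K = K1")
    case True
    then have "Inf (g ` opt_range K g i j) = g k"
      using k opt by (intro Inf_eqI) auto
    then show ?thesis
      using set_val_opt_range[OF ij False] True by simp
  next
    case K: False
    then have "Sup (g ` opt_range K g i j) = g k"
      using k opt by (intro Sup_eqI) auto
    then show ?thesis
      using set_val_opt_range[OF ij False] K by simp
  qed
qed

lemma opt_code_exists: "\<exists>k<j. opt_code K d i j k"
proof (cases "\<forall>l<j. g l = \<infinity>")
  case True
  then show ?thesis
    using ij opt_code_iff by blast
next
  case False
  let ?R = "opt_range K g i j"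
  have fin_R: "finite ?R"
    by (rule finite_subset[of _ "{..<j}"]) (auto simp: opt_range_def)
  \<comment> \<open>The positions are restricted to the cycle only if the cycle carries a weight
    other than \<open>\<infinity>\<close>.\<close>
  have "?R \<noteq> {}"
    using False by (auto simp: opt_range_def)
  then have "Min (g ` ?R) \<in> g ` ?R" "Max (g ` ?R) \<in> g ` ?R"
    using fin_R by simp_all
  then obtain k k' where k: "k \<in> ?R" "g k = Min (g ` ?R)" and k': "k' \<in> ?R" "g k' = Max (g ` ?R)"
    by (metis imageE)
  have "g k \<le> g l" "g l \<le> g k'" if "l \<in> ?R" for l
    using fin_R that k(2) k'(2) by simp_all
  then have "\<exists>k\<in>?R. \<forall>l\<in>?R. if K = K1 then g k \<le> g l else g l \<le> g k"
    using k(1) k'(1) by (cases "K = K1") auto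
  moreover have "k < j" if "k \<in> ?R" for k
    using that by (simp add: opt_range_def)
  ultimately show ?thesis
    using opt_code_iff by blast
qed

end

context
  fixes m M i j x :: nat and N :: wba
  assumes m: "0 < m" and ij: "i < j"
begin

abbreviation (input) "E y \<equiv> edge (dig m x) (dig M y)"
abbreviation (input) "lasso y \<equiv> (dig M y 0, E y ` {..<j}, E y ` {i..<j})"

lemma step_code_enc:
  assumes "dig M y l < nstates N" "dig M y (Suc l) < nstates N"
  shows "step_code m M (enc_wba m N) x y l = enc_qbar (wt N (dig M y l) (dig m x l) (dig M y (Suc l)))"
  unfolding step_code_def using assms m by (intro enc_wba_decode(4) dig_less)

lemma lasso_code_iff:
  "lasso_code m M (enc_wba m N) x y i j \<longleftrightarrow> dig M y i = dig M y j \<and> accepted N (lasso y)"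
proof -
  let ?n = "nstates N"
  let ?c = "enc_wba m N"
  have weight: "edge_weight N (E y l) \<noteq> -\<infinity> \<longleftrightarrow>
      dig M y l < ?n \<and> dig M y (Suc l) < ?n \<and> step_code m M ?c x y l \<noteq> 0" for l
    by (auto simp: edge_weight_def edge_def step_code_enc enc_qbar_eq_0 emb_eq_MInf simp del: neq0_conv)
  have A: "-\<infinity> \<notin> edge_weight N ` E y ` {..<j} \<longleftrightarrow>
      (\<forall>l<j. dig M y l < ?n \<and> dig M y (Suc l) < ?n \<and> step_code m M ?c x y l \<noteq> 0)"
    unfolding weight[symmetric] image_image image_iff Bex_def lessThan_iff by metis
  have B: "fst ` E y ` {i..<j} \<inter> fin N \<noteq> {} \<longleftrightarrow> (\<exists>l<j. i \<le> l \<and> dig M y l \<in> fin N)"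
    unfolding image_image edge_def fst_conv by (auto simp: disjoint_iff)
  show ?thesis
  \<comment> \<open>The lists of initial and final states decode correctly only at states of
    \<open>N\<close>; where the range condition fails, both sides are false.\<close>
  proof (cases "\<forall>l<j. dig M y l < ?n \<and> dig M y (Suc l) < ?n \<and> step_code m M ?c x y l \<noteq> 0")
    case True
    then have "dig M y 0 < ?n" "\<And>l. l < j \<Longrightarrow> dig M y l < ?n"
      using ij by blast+
    then show ?thesis
      using True unfolding lasso_code_def accepted_def prod.case A B enc_wba_decode(1)
      by (auto simp: enc_wba_decode(2,3)[simplified])
  next
    case False
    then show ?thesis
      unfolding lasso_code_def accepted_def prod.case A B enc_wba_decode(1) by blast
  qed
qed

text \<open>An optimal position exists, and every optimal position carries the same value. So it
  does not matter which ones the existential quantifiers in \<open>dominated_code\<close>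
  select.\<close>

lemma accepted_lasso_value:
  assumes "accepted N (lasso y)"
  shows "\<exists>k<j. opt_code K (step_code m M (enc_wba m N) x y) i j k"
    and "\<And>k. k < j \<Longrightarrow> opt_code K (step_code m M (enc_wba m N) x y) i j k \<Longrightarrow>
      \<exists>u. u \<noteq> NegInf \<and> step_code m M (enc_wba m N) x y k = enc_qbar u \<and> run_value K N (lasso y) = emb u"
proof -
  let ?d = "step_code m M (enc_wba m N) x y"
  let ?v = "\<lambda>l. wt N (dig M y l) (dig m x l) (dig M y (Suc l))"
  let ?g = "\<lambda>l. edge_weight N (E y l)"
  have no: "?g l \<noteq> -\<infinity>" if "l < j" for l
  proof -
    have "?g l \<in> edge_weight N ` E y ` {..<j}"
      using that by blast
    then show ?thesis
      using assms unfolding accepted_def prod.case by metis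
  qed
  then have n: "dig M y l < nstates N" "dig M y (Suc l) < nstates N" if "l < j" for l
    using that by (fastforce simp: edge_weight_def edge_def split: if_splits)+
  have d: "?d l = enc_qbar (?v l)" and g: "?g l = emb (?v l)" if "l < j" for l
    using n[OF that] by (simp_all add: step_code_enc edge_weight_def edge_def)
  have v: "?v l \<noteq> NegInf" if "l < j" for l
    using no[OF that] g[OF that] by auto
  show "\<exists>k<j. opt_code K ?d i j k"
    using ij d v g by (rule opt_code_exists)
  fix k assume k: "k < j" "opt_code K ?d i j k"
  have "?g k = set_val K (?g ` {..<j}) (?g ` {i..<j})"
    using ij d v g k by (rule opt_code_set_val)
  then have "run_value K N (lasso y) = emb (?v k)"
    using g[OF k(1)] by (simp add: run_value_def image_image)
  then show "\<exists>u. u \<noteq> NegInf \<and> ?d k = enc_qbar u \<and> run_value K N (lasso y) = emb u"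
    using v[OF k(1)] d[OF k(1)] by blast
qed

lemma accepted_lassos_code:
  "{t \<in> lassos (prof M (dig m x) 0 i) (prof M (dig m x) i j). accepted N t} =
     lasso ` {y. y < M ^ Suc j \<and> lasso_code m M (enc_wba m N) x y i j}"
  unfolding lassos_code[OF ij] lasso_code_iff by blast

end

text \<open>A supremum over a finite nonempty set is attained. If \<open>B\<close> is empty its
  supremum is \<open>-\<infinity>\<close>, and the second hypothesis then forces \<open>A\<close> to
  be empty as well.\<close>

lemma SUP_le_SUP_iff_finite:
  fixes f g :: "_ \<Rightarrow> ereal"
  assumes "finite B" "\<And>a. a \<in> A \<Longrightarrow> f a \<noteq> -\<infinity>"
  shows "(SUP a\<in>A. f a) \<le> (SUP b\<in>B. g b) \<longleftrightarrow> (\<forall>a\<in>A. \<exists>b\<in>B. f a \<le> g b)"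
proof
  assume le: "(SUP a\<in>A. f a) \<le> (SUP b\<in>B. g b)"
  show "\<forall>a\<in>A. \<exists>b\<in>B. f a \<le> g b"
  proof
    fix a assume a: "a \<in> A"
    then have fa: "f a \<le> (SUP b\<in>B. g b)"
      using le SUP_upper order_trans by metis
    have "B \<noteq> {}"
      using fa assms(2)[OF a] by (auto simp: bot_ereal_def)
    then have "(SUP b\<in>B. g b) \<in> g ` B"
      using assms(1) by (simp add: Max_Sup[symmetric])
    then show "\<exists>b\<in>B. f a \<le> g b"
      using fa by auto
  qed
next
  assume "\<forall>a\<in>A. \<exists>b\<in>B. f a \<le> g b"
  then show "(SUP a\<in>A. f a) \<le> (SUP b\<in>B. g b)"
    by (intro SUP_mono) blast
qed

lemma dominated_code_iff:
  assumes m: "0 < m" and ij: "i < j"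
  shows "dominated_code K m M (enc_wba m N) (enc_wba m N') x i j \<longleftrightarrow>
    lasso_value K N (prof M (dig m x) 0 i) (prof M (dig m x) i j) \<le>
    lasso_value K N' (prof M (dig m x) 0 i) (prof M (dig m x) i j)"
proof -
  let ?c = "enc_wba m N" and ?c' = "enc_wba m N'"
  let ?E = "\<lambda>y. edge (dig m x) (dig M y)"
  let ?t = "\<lambda>y. (dig M y 0, ?E y ` {..<j}, ?E y ` {i..<j})"
  let ?Y = "\<lambda>N. {y. y < M ^ Suc j \<and> lasso_code m M (enc_wba m N) x y i j}"
  have le: "(\<exists>k<j. \<exists>k'<j. opt_code K (step_code m M ?c x y) i j k \<and>
              opt_code K (step_code m M ?c' x y') i j k' \<and>
              le_code (step_code m M ?c x y k) (step_code m M ?c' x y' k')) \<longleftrightarrow>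
      run_value K N (?t y) \<le> run_value K N' (?t y')"
    if y: "y \<in> ?Y N" and y': "y' \<in> ?Y N'" for y y'
  proof -
    have acc: "accepted N (?t y)" and acc': "accepted N' (?t y')"
      using y y' lasso_code_iff[OF m ij] by auto
    have cmp: "le_code (step_code m M ?c x y k) (step_code m M ?c' x y' k') \<longleftrightarrow>
        run_value K N (?t y) \<le> run_value K N' (?t y')"
      if k: "k < j" "opt_code K (step_code m M ?c x y) i j k"
        and k': "k' < j" "opt_code K (step_code m M ?c' x y') i j k'" for k k'
    proof -
      obtain u where "u \<noteq> NegInf" "step_code m M ?c x y k = enc_qbar u" "run_value K N (?t y) = emb u"
        using accepted_lasso_value(2)[OF m ij acc k] by blast
      moreover obtain u' where "u' \<noteq> NegInf" "step_code m M ?c' x y' k' = enc_qbar u'"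
        "run_value K N' (?t y') = emb u'"
        using accepted_lasso_value(2)[OF m ij acc' k'] by blast
      ultimately show ?thesis
        by (simp add: le_code_iff)
    qed
    obtain k k' where "k < j" "opt_code K (step_code m M ?c x y) i j k"
      "k' < j" "opt_code K (step_code m M ?c' x y') i j k'"
      using accepted_lasso_value(1)[OF m ij acc] accepted_lasso_value(1)[OF m ij acc'] by blast
    then show ?thesis
      using cmp by blast
  qed
  have "dominated_code K m M ?c ?c' x i j \<longleftrightarrow>
      (\<forall>y\<in>?Y N. \<exists>y'\<in>?Y N'. \<exists>k<j. \<exists>k'<j. opt_code K (step_code m M ?c x y) i j k \<and>
              opt_code K (step_code m M ?c' x y') i j k' \<and>
              le_code (step_code m M ?c x y k) (step_code m M ?c' x y' k'))"
    unfolding dominated_code_def Ball_def Bex_def mem_Collect_eq by blast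
  also have "\<dots> \<longleftrightarrow> (\<forall>y\<in>?Y N. \<exists>y'\<in>?Y N'. run_value K N (?t y) \<le> run_value K N' (?t y'))"
    using le by (intro ball_cong bex_cong refl) blast
  also have "\<dots> \<longleftrightarrow> (\<forall>t\<in>?t ` ?Y N. \<exists>t'\<in>?t ` ?Y N'. run_value K N t \<le> run_value K N' t')"
    by blast
  also have "\<dots> \<longleftrightarrow> (SUP t\<in>?t ` ?Y N. run_value K N t) \<le> (SUP t\<in>?t ` ?Y N'. run_value K N' t)"
  proof (rule SUP_le_SUP_iff_finite[symmetric])
    show "finite (?t ` ?Y N')"
      by simp
    fix t assume "t \<in> ?t ` ?Y N"
    then obtain y where t: "t = ?t y" and "y \<in> ?Y N"
      by blast
    then have acc: "accepted N (?t y)"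
      using lasso_code_iff[OF m ij] by simp
    show "run_value K N t \<noteq> -\<infinity>"
      using accepted_lasso_value[OF m ij acc, where K = K] unfolding t by (metis emb_eq_MInf)
  qed
  finally show ?thesis
    unfolding lasso_value_def accepted_lassos_code[OF m ij] .
qed

theorem decision_correct:
  assumes m: "0 < m" and M: "nstates N \<le> M" "nstates N' \<le> M"
  shows "decision K m M (enc_wba m N) (enc_wba m N') \<longleftrightarrow>
    (\<forall>w. (\<forall>i. w i < m) \<longrightarrow> behavior K N w = behavior K N' w)"
proof -
  let ?P = "\<lambda>w k j i. prof M w 0 i = prof M w 0 j \<longrightarrow> prof M w i j = prof M w j k \<longrightarrow>
       prof M w i j = prof M w i k \<longrightarrow>
       lasso_value K N (prof M w 0 i) (prof M w i j) =
       lasso_value K N' (prof M w 0 i) (prof M w i j)"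
  have code: "(prof_eq_code m M x 0 i 0 j \<and> prof_eq_code m M x i j j k \<and> prof_eq_code m M x i j i k \<longrightarrow>
        dominated_code K m M (enc_wba m N) (enc_wba m N') x i j \<and>
        dominated_code K m M (enc_wba m N') (enc_wba m N) x i j) \<longleftrightarrow> ?P (dig m x) k j i"
    if "j < k" "i < j" for x k j i
  proof -
    have le: "0 \<le> i" "0 \<le> j" "i \<le> j" "j \<le> k" "i \<le> k"
      using that by simp_all
    show ?thesis
      unfolding prof_eq_code_iff[OF le(1,2)] prof_eq_code_iff[OF le(3,4)]
        prof_eq_code_iff[OF le(3,5)] dominated_code_iff[OF m that(2)]
        order_eq_iff[of "lasso_value K N (prof M (dig m x) 0 i) (prof M (dig m x) i j)"]
      by blast
  qed
  \<comment> \<open>Only the first \<open>k\<close> letters enter the profiles, so words may be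
    replaced by digit sequences of length \<open>k\<close>.\<close>
  have words: "(\<forall>x<m ^ k. ?P (dig m x) k j i) \<longleftrightarrow> (\<forall>w. (\<forall>l. w l < m) \<longrightarrow> ?P w k j i)"
    if ij: "j < k" "i < j" for k j i
  proof
    assume L: "\<forall>x<m ^ k. ?P (dig m x) k j i"
    show "\<forall>w. (\<forall>l. w l < m) \<longrightarrow> ?P w k j i"
    proof (intro allI impI)
      fix w :: "nat \<Rightarrow> nat" assume "\<forall>l. w l < m"
      then obtain x where x: "x < m ^ k" "\<And>l. l < k \<Longrightarrow> dig m x l = w l"
        using digits_exist[of k w m] by blast
      have "prof M w a b = prof M (dig m x) a b" if "a \<le> b" "b \<le> k" for a b
        using that x(2) by (intro prof_cong) auto
      then have eq: "prof M w 0 i = prof M (dig m x) 0 i" "prof M w 0 j = prof M (dig m x) 0 j"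
        "prof M w i j = prof M (dig m x) i j" "prof M w j k = prof M (dig m x) j k"
        "prof M w i k = prof M (dig m x) i k"
        using ij by auto
      assume "prof M w 0 i = prof M w 0 j" "prof M w i j = prof M w j k" "prof M w i j = prof M w i k"
      then show "lasso_value K N (prof M w 0 i) (prof M w i j) =
          lasso_value K N' (prof M w 0 i) (prof M w i j)"
        using L x(1) unfolding eq by blast
    qed
  qed (use m dig_less in blast)
  have bound: "prof_bound m M = card (prof_space m M)"
    by (simp add: prof_bound_def card_prof_space)
  have "decision K m M (enc_wba m N) (enc_wba m N') \<longleftrightarrow>
      (\<forall>k\<le>3 * card (prof_space m M). \<forall>j<k. \<forall>i<j. \<forall>x<m ^ k. ?P (dig m x) k j i)"
    unfolding decision_def bound less_Suc_eq_le by (intro all_cong code)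
  also have "\<dots> \<longleftrightarrow>
      (\<forall>k\<le>3 * card (prof_space m M). \<forall>j<k. \<forall>i<j. \<forall>w. (\<forall>l. w l < m) \<longrightarrow> ?P w k j i)"
    by (intro all_cong words)
  also have "\<dots> \<longleftrightarrow> (\<forall>w. (\<forall>i. w i < m) \<longrightarrow> behavior K N w = behavior K N' w)"
    unfolding equivalence_iff_lassos[OF M] ..
  finally show ?thesis .
qed

theorem theorem8:
  fixes m :: nat and K :: valmonoid
  assumes "0 < m"
  shows "\<exists>f :: recf. \<forall>N N'. wf_wba m N \<longrightarrow> wf_wba m N' \<longrightarrow>
           rec_eval f [prod_encode (enc_wba m N, enc_wba m N')]
             (if (\<forall>w. (\<forall>i. w i < m) \<longrightarrow> behavior K N w = behavior K N' w) then 1 else 0)"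
proof -
  \<comment> \<open>Any common bound on both numbers of states serves; the sum is read off the two
    codes by a single addition.\<close>
  let ?M = "\<lambda>z. nth_code (pfst z) 0 + nth_code (psnd z) 0"
  have "decidable (\<lambda>z. decision K m (?M z) (pfst z) (psnd z))"
    by (intro decidable_decision computable_intros computable_nth_code)
  then obtain f where f: "\<And>z. rec_eval f [z] (of_bool (decision K m (?M z) (pfst z) (psnd z)))"
    unfolding decidable_def computable_def by blast
  show ?thesis
  proof (intro exI allI impI)
    fix N N'
    have "decision K m (nstates N + nstates N') (enc_wba m N) (enc_wba m N') \<longleftrightarrow>
        (\<forall>w. (\<forall>i. w i < m) \<longrightarrow> behavior K N w = behavior K N' w)"
      using assms by (intro decision_correct) simp_all
    then show "rec_eval f [prod_encode (enc_wba m N, enc_wba m N')]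
             (if (\<forall>w. (\<forall>i. w i < m) \<longrightarrow> behavior K N w = behavior K N' w) then 1 else 0)"
      using f[of "prod_encode (enc_wba m N, enc_wba m N')"]
      by (simp add: enc_wba_decode(1) of_bool_def)
  qed
qed

end
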